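(* Let $0<\alpha<1$ and consider the problem described in the context with the mass density $\rho$ unknown (Case 4), the data $k,c,\ell>0$, $T_m$, $T_0>T_m$, $q_0>0$ being given. For any such data, the equation $$\frac{x\left[1-W\left(-x;-\frac{\alpha}{2},1\right)\right]}{M_{\alpha/2}(x)}=\frac{c(T_0-T_m)\,\Gamma\left(1-\frac{\alpha}{2}\right)}{\ell\,\Gamma\left(1+\frac{\alpha}{2}\right)},\quad x>0,$$ has a unique solution $\xi_\alpha>0$, and the solution of Case 4 is given by $$\rho=\rho_\alpha=\frac{q_0^2\,\Gamma^2\left(1-\frac{\alpha}{2}\right)}{kc(T_0-T_m)^2}\left[1-W\left(-\xi_\alpha;-\frac{\alpha}{2},1\right)\right]^2,$$ $$T_\alpha(x,t)=T_0-\frac{T_0-T_m}{1-W\left(-\xi_\alpha;-\frac{\alpha}{2},1\right)}\left[1-W\left(-\frac{x}{\lambda_\alpha t^{\alpha/2}};-\frac{\alpha}{2},1\right)\right],\qquad s_\alpha(t)=\lambda_\alpha\xi_\alpha t^{\alpha/2},$$ where $$\lambda_\alpha=\frac{k(T_0-T_m)}{q_0\,\Gamma\left(1-\frac{\alpha}{2}\right)\left[1-W\left(-\xi_\alpha;-\frac{\alpha}{2},1\right)\right]}.$$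
   Context: For $0<\alpha<1$ the Caputo fractional derivative of a function $f$ of $t$ is $D^\alpha f(t)=\frac{1}{\Gamma(1-\alpha)}\int_0^t \frac{f'(\tau)}{(t-\tau)^\alpha}\,d\tau$, where $\Gamma$ is Euler's Gamma function. The Wright function is $W(z;a,b)=\sum_{n=0}^{\infty}\frac{z^n}{n!\,\Gamma(na+b)}$ for $z\in\mathbb{C}$, $a>-1$, $b\in\mathbb{R}$; the Mainardi function is $M_\nu(z)=W(-z;-\nu,1-\nu)$ for $\nu<1$. The problem: $\rho,k,c,\ell$ are positive constants (density, conductivity, specific heat, latent heat), $\lambda^2=k/(\rho c)$, $T_m$ is the melting temperature, $T_0>T_m$ and $q_0>0$ are constants. Find $x=s(t)$, $T=T(x,t)$ and the unknown coefficient such that: $D^\alpha T=\lambda^2 T_{xx}$ for $0<x<s(t)$, $t>0$ (Caputo derivative in $t$); $s(0)=0$; $T(x,0)=T(+\infty,t)=T_m$ for $x>0,t>0$; $T(s(t),t)=T_m$; $-kT_x(s(t),t)=\rho\ell\, D^\alpha s(t)$; $T(0,t)=T_0$; $kT_x(0,t)=-q_0/t^{\alpha/2}$, for all $t>0$.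
   Formalization: The conditions T(x,0)=T(+∞,t)=T_m, which the stated T_α violates (its limit is T_0-(T_0-T_m)/(1-W(-ξ_α;-α/2,1)) < T_m), are not claimed; "the solution is given by" means the stated ρ, T, s satisfy all other conditions. *)

theory Defs
  imports "HOL-Analysis.Analysis"
begin

text \<open>Wright function W(z;a,b) = sum_n z^n / (n! Gamma(n a + b)) (real argument).
  At poles of Gamma the library sets Gamma = 0, so the term is 0, matching 1/Gamma = 0.\<close>
definition Wright :: "real \<Rightarrow> real \<Rightarrow> real \<Rightarrow> real" where
  "Wright z a b = (\<Sum>n. z ^ n / (fact n * Gamma (real n * a + b)))"

definition Mainardi :: "real \<Rightarrow> real \<Rightarrow> real" where
  "Mainardi \<nu> z = Wright (- z) (- \<nu>) (1 - \<nu>)"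

definition caputo :: "real \<Rightarrow> (real \<Rightarrow> real) \<Rightarrow> real \<Rightarrow> real" where
  "caputo \<alpha> f t = integral {0..t} (\<lambda>\<tau>. deriv f \<tau> / (t - \<tau>) powr \<alpha>) / Gamma (1 - \<alpha>)"

definition caputo_exists :: "real \<Rightarrow> (real \<Rightarrow> real) \<Rightarrow> real \<Rightarrow> bool" where
  "caputo_exists \<alpha> f t \<longleftrightarrow> (\<forall>\<tau>\<in>{0<..<t}. f differentiable (at \<tau>)) \<and>
     (\<lambda>\<tau>. deriv f \<tau> / (t - \<tau>) powr \<alpha>) integrable_on {0..t}"

end

theory Submission
  imports Defs "HOL-Complex_Analysis.Complex_Analysis"
begin

text \<open>Put \<open>\<nu> = \<alpha>/2\<close>. The functions \<open>g\<^sub>b(x,t) = t\<^bsup>b-1\<^esup> W(-x t\<^bsup>-\<nu>\<^esup>; -\<nu>, b)\<close> are the inverse Laplace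
  transforms of \<open>s\<^bsup>-b\<^esup> exp(-x s\<^bsup>\<nu>\<^esup>)\<close>. Since \<open>\<nu> < 1/2\<close>, the inversion integral converges absolutely both on
  the two sides of the negative axis, where it expands into the Wright series, and on the imaginary
  axis, where it defines a function of all real \<open>t\<close> that vanishes for \<open>t < 0\<close>; fractional integration
  of order \<open>\<beta>\<close> therefore just multiplies the integrand by \<open>s\<^bsup>-\<beta>\<^esup>\<close>, i.e. sends \<open>g\<^sub>b\<close> to \<open>g\<^bsub>b+\<beta>\<^esub>\<close>. As
  \<open>\<partial>g\<^sub>1/\<partial>t = g\<^sub>0\<close> and \<open>\<partial>\<^sup>2g\<^sub>1/\<partial>x\<^sup>2 = g\<^bsub>1-2\<nu>\<^esub>\<close>, this gives the fractional heat equation for the similarity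
  profile. A minimum principle for the fractional derivative of order \<open>\<nu>\<close> shows \<open>M\<^sub>\<nu> \<ge> 0\<close>, hence
  \<open>g\<^sub>0 \<ge> 0\<close>, hence \<open>M\<^sub>\<nu>' \<le> 0\<close>. So \<open>M\<^sub>\<nu>\<close> is positive and decreasing, and the left-hand side of the front
  equation increases from \<open>0\<close> to \<open>\<infinity>\<close>.\<close>

section \<open>Integrals over horizontal lines\<close>

text \<open>The change of variables u = exp r is carried out for absolutely integrable functions in
  the Henstock-Kurzweil setting; Borel measurability of \<open>f\<close> then moves both
  integrability and value to \<open>lborel\<close>.\<close>

lemma integral_exp_substitution:
  fixes f :: "real \<Rightarrow> 'a :: euclidean_space"
  assumes f [measurable]: "f \<in> borel_measurable borel"
  shows "set_integrable lborel {0<..} f \<longleftrightarrow> integrable lborel (\<lambda>r. exp r *\<^sub>R f (exp r))"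
    and "set_integrable lborel {0<..} f \<Longrightarrow>
           (LINT u:{0<..}|lborel. f u) = (LINT r|lborel. exp r *\<^sub>R f (exp r))"
proof -
  have range: "range exp = {0::real<..}"
    by (auto simp: image_iff) (metis exp_ln)
  have iff: "(\<lambda>x. \<bar>exp x\<bar> *\<^sub>R f (exp x)) absolutely_integrable_on UNIV \<and>
        integral UNIV (\<lambda>x. \<bar>exp x\<bar> *\<^sub>R f (exp x)) = b \<longleftrightarrow>
        f absolutely_integrable_on range exp \<and> integral (range exp) f = b" for b
    by (rule has_absolute_integral_change_of_variables_real)
       (auto intro!: derivative_eq_intros injI)
  have L: "(\<lambda>x. \<bar>exp x\<bar> *\<^sub>R f (exp x)) absolutely_integrable_on UNIV \<longleftrightarrow>
      integrable lborel (\<lambda>r. exp r *\<^sub>R f (exp r))"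
    unfolding set_integrable_def by (simp add: integrable_completion)
  have R: "f absolutely_integrable_on {0<..} \<longleftrightarrow> set_integrable lborel {0<..} f"
    unfolding set_integrable_def by (subst integrable_completion) auto
  show 1: "set_integrable lborel {0<..} f \<longleftrightarrow> integrable lborel (\<lambda>r. exp r *\<^sub>R f (exp r))"
    unfolding L[symmetric] R[symmetric] using iff unfolding range by blast
  assume si: "set_integrable lborel {0<..} f"
  have "set_integrable lborel UNIV (\<lambda>r. exp r *\<^sub>R f (exp r))"
    using si 1 by (simp add: set_integrable_def)
  from set_borel_integral_eq_integral(2)[OF this]
  have "(LINT r|lborel. exp r *\<^sub>R f (exp r)) = integral UNIV (\<lambda>r. exp r *\<^sub>R f (exp r))"
    by (simp add: set_lebesgue_integral_def)
  also have "\<dots> = integral {0<..} f"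
  proof -
    have "f absolutely_integrable_on range exp \<and> integral (range exp) f = integral {0<..} f"
      unfolding range using si R by blast
    then have "integral UNIV (\<lambda>x. \<bar>exp x\<bar> *\<^sub>R f (exp x)) = integral {0<..} f"
      using iff by blast
    then show ?thesis by (simp only: abs_exp_cancel)
  qed
  also have "\<dots> = (LINT u:{0<..}|lborel. f u)"
    using set_borel_integral_eq_integral(2)[OF si] by simp
  finally show "(LINT u:{0<..}|lborel. f u) = (LINT r|lborel. exp r *\<^sub>R f (exp r))" by simp
qed

text \<open>Euler's integral for \<open>Gamma c\<close> in the variable r = ln u, followed by a
  translation by \<open>ln t\<close>, which produces the factor \<open>t powr (- c)\<close>.\<close>

lemma Gamma_integral_log:
  fixes c t :: real
  assumes "0 < c" "0 < t"
  shows "has_bochner_integral lborel (\<lambda>r. exp (c * r - t * exp r)) (Gamma c * t powr (- c))"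
proof -
  define f where "f u = u powr (c - 1) / exp u" for u :: real
  have [measurable]: "f \<in> borel_measurable borel" unfolding f_def by measurable
  have hi: "(f has_integral Gamma c) {0<..}"
  proof -
    have "(f has_integral Gamma c) {0..}"
      using Gamma_integral_real[OF assms(1)] by (simp add: f_def[abs_def])
    then show ?thesis
      by (rule has_integral_spike_set_eq[THEN iffD1, rotated 2])
         (rule negligible_subset[of "{0}"], simp, force)+
  qed
  have ai: "f absolutely_integrable_on {0<..}"
    using hi by (subst absolutely_integrable_on_iff_nonneg) (auto simp: f_def integrable_on_def)
  then have si: "set_integrable lborel {0<..} f"
    unfolding set_integrable_def by (subst (asm) integrable_completion) auto
  have eq: "exp r * f (exp r) = exp (c * r - exp r)" for r
    by (simp add: f_def powr_def exp_diff[symmetric] exp_add[symmetric] algebra_simps)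
  have 1: "has_bochner_integral lborel (\<lambda>r. exp (c * r - exp r)) (Gamma c)"
    using integral_exp_substitution[of f] si set_borel_integral_eq_integral(2)[OF si] hi
    by (auto simp: eq has_bochner_integral_iff integral_unique)
  have "has_bochner_integral lborel (\<lambda>r. exp (c * (ln t + 1 * r) - exp (ln t + 1 * r))) (Gamma c /\<^sub>R \<bar>1\<bar>)"
    using lborel_has_bochner_integral_real_affine_iff[of 1 "\<lambda>r. exp (c * r - exp r)" "Gamma c" "ln t"] 1
    by simp
  then have "has_bochner_integral lborel (\<lambda>r. t powr (-c) * exp (c * (ln t + 1 * r) - exp (ln t + 1 * r))) (t powr (-c) * Gamma c)"
    by (intro has_bochner_integral_mult_right) auto
  moreover have "t powr (-c) * exp (c * (ln t + 1 * r) - exp (ln t + 1 * r)) = exp (c * r - t * exp r)" for r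
    using assms by (simp add: powr_def exp_add exp_add[symmetric] algebra_simps)
  ultimately show ?thesis by (simp add: mult.commute)
qed

section \<open>Envelopes and the shift of horizontal lines\<close>

text \<open>A common majorant of the integrands: for positive parameters it decays exponentially as
  r tends to minus infinity and doubly exponentially as r tends to plus infinity.\<close>

definition envelope :: "real \<Rightarrow> real \<Rightarrow> real \<Rightarrow> real \<Rightarrow> real" where
  "envelope c a \<kappa> r = exp (c * r - a * exp (\<kappa> * r))"

lemma envelope_pos: "0 < envelope c a \<kappa> r"
  by (simp add: envelope_def)

lemma envelope_measurable [measurable]: "envelope c a \<kappa> \<in> borel_measurable borel"
  unfolding envelope_def by measurable

lemma integrable_envelope:
  assumes "0 < c" "0 < a" "0 < \<kappa>"
  shows "integrable lborel (envelope c a \<kappa>)"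
proof -
  have "integrable lborel (\<lambda>r. exp (c / \<kappa> * r - a * exp r))"
    using Gamma_integral_log[of "c / \<kappa>" a] assms by (simp add: has_bochner_integral_iff)
  from lborel_integrable_real_affine[OF this, of \<kappa> 0] assms show ?thesis
    by (simp add: envelope_def[abs_def])
qed

lemma envelope_tendsto:
  assumes "0 < c" "0 < a" "0 < \<kappa>"
  shows "(envelope c a \<kappa> \<longlongrightarrow> 0) at_top" "(envelope c a \<kappa> \<longlongrightarrow> 0) at_bot"
proof -
  show "(envelope c a \<kappa> \<longlongrightarrow> 0) at_top"
    unfolding envelope_def using assms by real_asymp
  show "(envelope c a \<kappa> \<longlongrightarrow> 0) at_bot"
    unfolding envelope_def using assms by real_asymp
qed

text \<open>Cauchy's theorem for an infinite strip: the truncated line integrals differ by the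
  integrals over the vertical edges, which are at most the height of the strip times the envelope
  and vanish in the limit.\<close>

lemma integral_horizontal_line_shift:
  fixes \<Psi> :: "complex \<Rightarrow> complex"
  assumes hol: "\<Psi> holomorphic_on UNIV" and pos: "0 < c" "0 < a" "0 < \<kappa>" and le: "\<theta>\<^sub>1 \<le> \<theta>\<^sub>2"
    and bound: "\<And>r \<theta>. \<theta> \<in> {\<theta>\<^sub>1..\<theta>\<^sub>2} \<Longrightarrow> norm (\<Psi> (Complex r \<theta>)) \<le> envelope c a \<kappa> r"
  shows "(LINT r|lborel. \<Psi> (Complex r \<theta>\<^sub>1)) = (LINT r|lborel. \<Psi> (Complex r \<theta>\<^sub>2))"
proof -
  \<comment> \<open>An entire integrand has a primitive, so every edge integral of the rectangle is
    a difference of values of \<open>P\<close> at the corners.\<close>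
  obtain P where P: "\<And>w. (P has_field_derivative \<Psi> w) (at w)"
    using holomorphic_convex_primitive'[OF convex_UNIV open_UNIV hol] by auto
  have Complex_eq': "Complex r \<theta> = of_real r + \<i> * of_real \<theta>" for r \<theta>
    by (simp add: complex_eq_iff)
  have cont: "continuous_on UNIV (\<lambda>r. \<Psi> (Complex r \<theta>))" for \<theta>
    unfolding Complex_eq'
    by (intro continuous_on_compose2[OF holomorphic_on_imp_continuous_on[OF hol]] continuous_intros) auto
  then have meas [measurable]: "(\<lambda>r. \<Psi> (Complex r \<theta>)) \<in> borel_measurable borel" for \<theta>
    by (rule borel_measurable_continuous_onI)
  have ftc: "(LINT r|lborel. indicator {- real n..real n} r *\<^sub>R \<Psi> (Complex r \<theta>)) =
      P (Complex n \<theta>) - P (Complex (- n) \<theta>)" for n \<theta>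
  proof (rule integral_FTC_Icc)
    show "((\<lambda>r. P (Complex r \<theta>)) has_vector_derivative \<Psi> (Complex x \<theta>)) (at x within {- real n..real n})" for x
    proof -
      have "((\<lambda>r. P (of_real r + \<i> * of_real \<theta>)) has_vector_derivative 1 * \<Psi> (of_real x + \<i> * of_real \<theta>)) 
            (at x within {- real n..real n})"
        by (rule field_vector_diff_chain_within[unfolded o_def])
           (auto intro!: derivative_eq_intros has_field_derivative_at_within[OF P])
      then show ?thesis by (simp add: Complex_eq')
    qed
  qed (auto intro: continuous_on_subset[OF cont])
  have lim: "(\<lambda>n. P (Complex (real n) \<theta>) - P (Complex (- real n) \<theta>)) \<longlonglongrightarrow> (LINT r|lborel. \<Psi> (Complex r \<theta>))"
    if \<theta>: "\<theta> \<in> {\<theta>\<^sub>1..\<theta>\<^sub>2}" for \<theta>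
    unfolding ftc[symmetric]
  proof (rule integral_dominated_convergence)
    show "integrable lborel (envelope c a \<kappa>)" using integrable_envelope pos by blast
    show "AE x in lborel. norm (indicator {- real n..real n} x *\<^sub>R \<Psi> (Complex x \<theta>)) \<le> envelope c a \<kappa> x" for n
      using bound[OF \<theta>] by (auto simp: indicator_def intro: less_imp_le[OF envelope_pos])
    show "AE x in lborel. (\<lambda>n. indicator {- real n..real n} x *\<^sub>R \<Psi> (Complex x \<theta>)) \<longlonglongrightarrow> \<Psi> (Complex x \<theta>)"
    proof (rule AE_I2)
      fix x :: real
      obtain N where N: "\<bar>x\<bar> \<le> real N" using real_arch_simple by blast
      then have "eventually (\<lambda>n. indicator {- real n..real n} x *\<^sub>R \<Psi> (Complex x \<theta>) = \<Psi> (Complex x \<theta>)) sequentially"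
        unfolding eventually_sequentially by (intro exI[of _ N]) (auto simp: indicator_def)
      then show "(\<lambda>n. indicator {- real n..real n} x *\<^sub>R \<Psi> (Complex x \<theta>)) \<longlonglongrightarrow> \<Psi> (Complex x \<theta>)"
        by (rule tendsto_eventually)
    qed
  qed auto
  have diff: "norm (P (Complex r \<theta>\<^sub>1) - P (Complex r \<theta>\<^sub>2)) \<le> envelope c a \<kappa> r * norm (\<theta>\<^sub>1 - \<theta>\<^sub>2)" for r
  proof (rule differentiable_bound[of "{\<theta>\<^sub>1..\<theta>\<^sub>2}" "\<lambda>\<theta>. P (Complex r \<theta>)" "\<lambda>\<theta> h. h *\<^sub>R (\<i> * \<Psi> (Complex r \<theta>))"])
    fix \<theta> assume \<theta>: "\<theta> \<in> {\<theta>\<^sub>1..\<theta>\<^sub>2}"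
    have "((\<lambda>\<theta>. P (of_real r + \<i> * of_real \<theta>)) has_vector_derivative \<i> * \<Psi> (of_real r + \<i> * of_real \<theta>)) 
            (at \<theta> within {\<theta>\<^sub>1..\<theta>\<^sub>2})"
      by (rule field_vector_diff_chain_within[unfolded o_def])
         (auto intro!: derivative_eq_intros has_vector_derivative_mult_right has_field_derivative_at_within[OF P])
    then show "((\<lambda>\<theta>. P (Complex r \<theta>)) has_derivative (\<lambda>h. h *\<^sub>R (\<i> * \<Psi> (Complex r \<theta>)))) (at \<theta> within {\<theta>\<^sub>1..\<theta>\<^sub>2})"
      by (simp add: Complex_eq' has_vector_derivative_def)
    show "onorm (\<lambda>h. h *\<^sub>R (\<i> * \<Psi> (Complex r \<theta>))) \<le> envelope c a \<kappa> r"
      by (rule onorm_le) (use bound[OF \<theta>, of r] in \<open>auto simp: norm_mult mult.commute intro!: mult_left_mono\<close>)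
  qed (use le in auto)
  have nat_top: "filterlim real at_top sequentially" "filterlim (\<lambda>n. - real n) at_bot sequentially"
    by real_asymp+
  \<comment> \<open>The four corner values are regrouped along the vertical edges, where
    \<open>diff\<close> applies.\<close>
  have "(\<lambda>n. (P (Complex (real n) \<theta>\<^sub>1) - P (Complex (- real n) \<theta>\<^sub>1)) - (P (Complex (real n) \<theta>\<^sub>2) - P (Complex (- real n) \<theta>\<^sub>2))) \<longlonglongrightarrow> 0"
  proof (rule Lim_null_comparison)
    show "\<forall>\<^sub>F n in sequentially. norm ((P (Complex (real n) \<theta>\<^sub>1) - P (Complex (- real n) \<theta>\<^sub>1)) - (P (Complex (real n) \<theta>\<^sub>2) - P (Complex (- real n) \<theta>\<^sub>2)))
        \<le> envelope c a \<kappa> (real n) * norm (\<theta>\<^sub>1 - \<theta>\<^sub>2) + envelope c a \<kappa> (- real n) * norm (\<theta>\<^sub>1 - \<theta>\<^sub>2)"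
    proof (rule always_eventually, rule allI)
      fix n
      have "norm ((P (Complex (real n) \<theta>\<^sub>1) - P (Complex (- real n) \<theta>\<^sub>1)) - (P (Complex (real n) \<theta>\<^sub>2) - P (Complex (- real n) \<theta>\<^sub>2)))
        = norm ((P (Complex (real n) \<theta>\<^sub>1) - P (Complex (real n) \<theta>\<^sub>2)) - (P (Complex (- real n) \<theta>\<^sub>1) - P (Complex (- real n) \<theta>\<^sub>2)))"
        by (simp add: algebra_simps)
      also have "\<dots> \<le> norm (P (Complex (real n) \<theta>\<^sub>1) - P (Complex (real n) \<theta>\<^sub>2)) + norm (P (Complex (- real n) \<theta>\<^sub>1) - P (Complex (- real n) \<theta>\<^sub>2))"
        by (rule norm_triangle_ineq4)
      also have "\<dots> \<le> envelope c a \<kappa> (real n) * norm (\<theta>\<^sub>1 - \<theta>\<^sub>2) + envelope c a \<kappa> (- real n) * norm (\<theta>\<^sub>1 - \<theta>\<^sub>2)"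
        using diff by (intro add_mono)
      finally show "norm ((P (Complex (real n) \<theta>\<^sub>1) - P (Complex (- real n) \<theta>\<^sub>1)) - (P (Complex (real n) \<theta>\<^sub>2) - P (Complex (- real n) \<theta>\<^sub>2)))
        \<le> envelope c a \<kappa> (real n) * norm (\<theta>\<^sub>1 - \<theta>\<^sub>2) + envelope c a \<kappa> (- real n) * norm (\<theta>\<^sub>1 - \<theta>\<^sub>2)" .
    qed
    show "(\<lambda>n. envelope c a \<kappa> (real n) * norm (\<theta>\<^sub>1 - \<theta>\<^sub>2) + envelope c a \<kappa> (- real n) * norm (\<theta>\<^sub>1 - \<theta>\<^sub>2)) \<longlonglongrightarrow> 0"
      by (intro tendsto_add_zero tendsto_mult_left_zero filterlim_compose[OF envelope_tendsto(1)[OF pos] nat_top(1)]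
            filterlim_compose[OF envelope_tendsto(2)[OF pos] nat_top(2)])
  qed
  moreover have "(\<lambda>n. (P (Complex (real n) \<theta>\<^sub>1) - P (Complex (- real n) \<theta>\<^sub>1)) - (P (Complex (real n) \<theta>\<^sub>2) - P (Complex (- real n) \<theta>\<^sub>2)))
     \<longlonglongrightarrow> (LINT r|lborel. \<Psi> (Complex r \<theta>\<^sub>1)) - (LINT r|lborel. \<Psi> (Complex r \<theta>\<^sub>2))"
    using le by (intro tendsto_diff lim) auto
  ultimately show ?thesis
    using LIMSEQ_unique by fastforce
qed

section \<open>The Wright series\<close>

text \<open>Since \<nu> < 1, \<open>exp (\<nu> * r)\<close> is negligible against
  \<open>exp r\<close> for large r; to the left of the threshold \<open>R\<close> monotonicity
  bounds it by a constant.\<close>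

lemma exp_mono_bound:
  fixes z t \<nu> :: real
  assumes "0 \<le> z" "0 < t" "0 < \<nu>" "\<nu> < 1"
  obtains K where "\<And>r. z * exp (\<nu> * r) \<le> K + t * exp r"
proof -
  have "\<forall>\<^sub>F r in at_top. z * exp (\<nu> * r) \<le> t * exp r"
  proof (cases "z = 0")
    case False
    with assms have "0 < z" by simp
    then show ?thesis using assms by real_asymp
  qed (use assms in auto)
  then obtain R where R: "\<And>r. R \<le> r \<Longrightarrow> z * exp (\<nu> * r) \<le> t * exp r"
    by (auto simp: eventually_at_top_linorder)
  show thesis
  proof (rule that[of "z * exp (\<nu> * R)"])
    fix r
    show "z * exp (\<nu> * r) \<le> z * exp (\<nu> * R) + t * exp r"
    proof (cases "R \<le> r")
      case True
      then show ?thesis using R[OF True] assms by (simp add: add_increasing)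
    next
      case False
      then have "z * exp (\<nu> * r) \<le> z * exp (\<nu> * R)"
        using assms by (intro mult_left_mono) auto
      then show ?thesis using assms by (simp add: add_increasing2)
    qed
  qed
qed

lemma integrable_exp_growth:
  fixes c t z \<nu> :: real
  assumes "0 < c" "0 < t" "0 \<le> z" "0 < \<nu>" "\<nu> < 1"
  shows "integrable lborel (\<lambda>r. exp (c * r - t * exp r + z * exp (\<nu> * r)))"
proof -
  obtain K where K: "\<And>r. z * exp (\<nu> * r) \<le> K + t / 2 * exp r"
    using exp_mono_bound[of z "t / 2" \<nu>] assms by auto
  show ?thesis
  proof (rule Bochner_Integration.integrable_bound)
    show "integrable lborel (\<lambda>r. exp K * exp (c * r - t / 2 * exp r))"
      using Gamma_integral_log[of c "t / 2"] assms
      by (intro integrable_mult_right) (simp add: has_bochner_integral_iff)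
    show "AE r in lborel. norm (exp (c * r - t * exp r + z * exp (\<nu> * r)))
        \<le> norm (exp K * exp (c * r - t / 2 * exp r))"
    proof (rule AE_I2)
      fix r
      have "c * r - t * exp r + z * exp (\<nu> * r) \<le> K + (c * r - t / 2 * exp r)"
        using K[of r] by (simp add: algebra_simps)
      then show "norm (exp (c * r - t * exp r + z * exp (\<nu> * r)))
        \<le> norm (exp K * exp (c * r - t / 2 * exp r))"
        by (simp add: exp_add[symmetric])
    qed
  qed measurable
qed

text \<open>The n-th term is the integral of the n-th term of the expansion of exp(z exp(\<nu> r))
  against the weight exp(c r - t exp r), so the partial sums stay below the integral of the full
  exponential.\<close>

lemma summable_Gamma_power:
  fixes c t z \<nu> :: real
  assumes "0 < c" "0 < t" "0 \<le> z" "0 < \<nu>" "\<nu> < 1"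
  shows "summable (\<lambda>n. z ^ n / fact n * (Gamma (c + real n * \<nu>) * t powr (- (c + real n * \<nu>))))"
proof (rule summableI_nonneg_bounded)
  define u where "u n r = z ^ n / fact n * exp ((c + real n * \<nu>) * r - t * exp r)" for n r
  have pos: "0 < c + real n * \<nu>" for n using assms by (simp add: add_pos_nonneg)
  have hb: "has_bochner_integral lborel (u n) (z ^ n / fact n * (Gamma (c + real n * \<nu>) * t powr (- (c + real n * \<nu>))))" for n
    unfolding u_def[abs_def] using Gamma_integral_log[OF pos \<open>0 < t\<close>, of n] by (intro has_bochner_integral_mult_right) auto
  show "0 \<le> z ^ n / fact n * (Gamma (c + real n * \<nu>) * t powr (- (c + real n * \<nu>)))" for n
    using assms pos[of n] by (simp add: Gamma_real_pos less_imp_le)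
  fix N
  have u_eq: "u n r = exp (c * r - t * exp r) * ((z * exp (\<nu> * r)) ^ n / fact n)" for n r
    by (simp add: u_def power_mult_distrib exp_of_nat_mult[symmetric] exp_add[symmetric] algebra_simps)
  have "(\<Sum>n<N. z ^ n / fact n * (Gamma (c + real n * \<nu>) * t powr (- (c + real n * \<nu>)))) = (LINT r|lborel. (\<Sum>n<N. u n r))"
    using hb by (subst Bochner_Integration.integral_sum) (auto simp: has_bochner_integral_iff)
  also have "\<dots> \<le> (LINT r|lborel. exp (c * r - t * exp r + z * exp (\<nu> * r)))"
  proof (rule integral_mono)
    show "integrable lborel (\<lambda>r. \<Sum>n<N. u n r)" using hb by (auto simp: has_bochner_integral_iff)
    show "integrable lborel (\<lambda>r. exp (c * r - t * exp r + z * exp (\<nu> * r)))"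
      using integrable_exp_growth assms by simp
    fix r
    have "(\<Sum>n<N. (z * exp (\<nu> * r)) ^ n / fact n) \<le> exp (z * exp (\<nu> * r))"
    proof -
      have "(\<lambda>n. (z * exp (\<nu> * r)) ^ n / fact n) sums exp (z * exp (\<nu> * r))"
        using exp_converges[of "z * exp (\<nu> * r)"] by (simp add: divide_inverse mult.commute)
      then show ?thesis
        using assms sum_le_suminf[of "\<lambda>n. (z * exp (\<nu> * r)) ^ n / fact n" "{..<N}"]
        unfolding sums_iff by (simp del: power_mult_distrib)
    qed
    then show "(\<Sum>n<N. u n r) \<le> exp (c * r - t * exp r + z * exp (\<nu> * r))"
      unfolding u_eq sum_distrib_left[symmetric] by (simp add: exp_add)
  qed
  finally show "(\<Sum>n<N. z ^ n / fact n * (Gamma (c + real n * \<nu>) * t powr (- (c + real n * \<nu>))))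
     \<le> (LINT r|lborel. exp (c * r - t * exp r + z * exp (\<nu> * r)))" .
qed

section \<open>Reflection formula and the coefficients of the Wright series\<close>

text \<open>Writing the formula with \<open>rGamma\<close> keeps it valid when x is a positive
  integer: then both sides are 0.\<close>

lemma rGamma_reflection_real:
  fixes x :: real
  assumes "0 < x"
  shows "rGamma (1 - x) = Gamma x * sin (pi * x) / pi"
proof -
  have "complex_of_real (rGamma x * rGamma (1 - x)) = complex_of_real (sin (pi * x) / pi)"
    using rGamma_reflection_complex[of "of_real x"]
    by (simp add: rGamma_complex_of_real[symmetric] sin_of_real[symmetric])
  then have "rGamma x * rGamma (1 - x) = sin (pi * x) / pi"
    unfolding of_real_eq_iff .
  moreover have "Gamma x * rGamma x = 1"
    using Gamma_real_pos[OF assms] by (simp add: rGamma_inverse_Gamma)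
  ultimately have "Gamma x * (sin (pi * x) / pi) = rGamma (1 - x)"
    by (metis mult.assoc mult_1)
  then show ?thesis by simp
qed

text \<open>With \<open>rGamma\<close> the coefficients at the poles of Gamma are 0, which agrees
  with \<open>Gamma\<close> = 0 there and division by zero in the definition of
  \<open>Wright\<close>.\<close>

definition wright_coeff :: "real \<Rightarrow> real \<Rightarrow> nat \<Rightarrow> real" where
  "wright_coeff \<nu> b n = rGamma (b - real n * \<nu>) / fact n"

lemma Wright_eq_suminf: "Wright z (- \<nu>) b = (\<Sum>n. wright_coeff \<nu> b n * z ^ n)"
  unfolding Wright_def wright_coeff_def
  by (intro suminf_cong) (simp add: rGamma_inverse_Gamma field_simps)

text \<open>For b < 1 the reflection formula applies to every coefficient and bounds |rGamma(b - n
  \<nu>)| by Gamma(1 - b + n \<nu>); the series is then dominated by the Gamma series at t =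
  1.\<close>

lemma summable_wright_abs:
  assumes "b < 1" "0 < \<nu>" "\<nu> < 1"
  shows "summable (\<lambda>n. \<bar>wright_coeff \<nu> b n * z ^ n\<bar>)"
proof (rule summable_comparison_test)
  show "summable (\<lambda>n. \<bar>z\<bar> ^ n / fact n * (Gamma (1 - b + real n * \<nu>) * 1 powr (- (1 - b + real n * \<nu>))))"
    using assms by (intro summable_Gamma_power) auto
  show "\<exists>N. \<forall>n\<ge>N. norm \<bar>wright_coeff \<nu> b n * z ^ n\<bar> \<le> \<bar>z\<bar> ^ n / fact n * (Gamma (1 - b + real n * \<nu>) * 1 powr (- (1 - b + real n * \<nu>)))"
  proof (intro exI allI impI)
    fix n
    have pos: "0 < 1 - b + real n * \<nu>" using assms by (simp add: add_pos_nonneg)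
    have "\<bar>rGamma (b - real n * \<nu>)\<bar> = Gamma (1 - b + real n * \<nu>) * (\<bar>sin (pi * (1 - b + real n * \<nu>))\<bar> / pi)"
      using rGamma_reflection_real[OF pos] Gamma_real_pos[OF pos] by (simp add: abs_mult)
    also have "\<dots> \<le> Gamma (1 - b + real n * \<nu>) * 1"
      using Gamma_real_pos[OF pos] pi_ge_two
      by (intro mult_left_mono) (auto simp: divide_simps intro: order_trans[OF abs_sin_le_one])
    finally have "\<bar>rGamma (b - real n * \<nu>)\<bar> \<le> Gamma (1 - b + real n * \<nu>)" by simp
    then have "\<bar>z\<bar> ^ n / fact n * \<bar>rGamma (b - real n * \<nu>)\<bar> \<le> \<bar>z\<bar> ^ n / fact n * Gamma (1 - b + real n * \<nu>)"
      by (intro mult_left_mono) auto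
    then show "norm \<bar>wright_coeff \<nu> b n * z ^ n\<bar> \<le> \<bar>z\<bar> ^ n / fact n * (Gamma (1 - b + real n * \<nu>) * 1 powr (- (1 - b + real n * \<nu>)))"
      by (simp add: wright_coeff_def abs_mult power_abs mult_ac)
  qed
qed

text \<open>The inversion integrand \<open>exp(t\<sigma> - x\<sigma>\<^sup>\<nu>) \<sigma>\<^bsup>-b\<^esup> d\<sigma>\<close> in the variable \<open>w = log \<sigma>\<close>, where it is entire: rays from the
  origin become horizontal lines, and no branch cut is needed.\<close>
definition hankel :: "real \<Rightarrow> real \<Rightarrow> real \<Rightarrow> real \<Rightarrow> complex \<Rightarrow> complex" where
  "hankel \<nu> b x t w = exp (of_real (1 - b) * w + of_real t * exp w - of_real x * exp (of_real \<nu> * w))"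

text \<open>The function g_b(x,t), the inverse Laplace transform of s^(-b) exp(-x s^\<nu>). It is
  homogeneous of degree b - 1 when t is scaled by a factor and x by the \<nu>-th power of that
  factor.\<close>

definition wright_kernel :: "real \<Rightarrow> real \<Rightarrow> real \<Rightarrow> real \<Rightarrow> real" where
  "wright_kernel \<nu> b x t = t powr (b - 1) * Wright (- (x * t powr (- \<nu>))) (- \<nu>) b"

text \<open>Expanding \<open>exp (- x e\<^sup>\<nu>\<^sup>w)\<close> on the line \<open>Im w = \<pi>\<close>, i.e. on the negative real axis, and integrating
  termwise gives Gamma integrals; the reflection formula turns them into the Wright series.\<close>
lemma wright_kernel_eq_integral_pi:
  assumes "b < 1" "0 < \<nu>" "\<nu> < 1" "0 < t"
  shows "wright_kernel \<nu> b x t = Im (LINT r|lborel. hankel \<nu> b x t (Complex r pi)) / pi"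
proof -
  define c where "c n = 1 - b + real n * \<nu>" for n
  define d where "d n = (- x) ^ n / fact n" for n
  define f where "f n r = complex_of_real (d n * exp (c n * r - t * exp r)) * cis (pi * c n)" for n r
  have pos: "0 < c n" for n unfolding c_def using assms by (simp add: add_pos_nonneg)
  \<comment> \<open>On this line exp w = -exp r, so the time factor is a decaying weight and the
    n-th term is a Gamma integral times the constant phase \<open>cis (pi * c n)\<close>.\<close>
  have hb: "has_bochner_integral lborel (f n) (complex_of_real (d n * (Gamma (c n) * t powr (- c n))) * cis (pi * c n))" for n
    unfolding f_def[abs_def]
    using Gamma_integral_log[OF pos[of n] \<open>0 < t\<close>]
    by (intro has_bochner_integral_mult_left has_bochner_integral_of_real has_bochner_integral_mult_right) auto
  have int: "integrable lborel (f n)" for n using hb by (auto simp: has_bochner_integral_iff)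
  have norm_f: "norm (f n r) = \<bar>d n\<bar> * exp (c n * r - t * exp r)" for n r
    by (simp add: f_def norm_mult abs_mult)
  have hbn: "has_bochner_integral lborel (\<lambda>r. norm (f n r)) (\<bar>d n\<bar> * (Gamma (c n) * t powr (- c n)))" for n
    unfolding norm_f
    using Gamma_integral_log[OF pos[of n] \<open>0 < t\<close>] by (intro has_bochner_integral_mult_right) auto
  have sumn: "summable (\<lambda>n. LINT r|lborel. norm (f n r))"
    using summable_Gamma_power[of "1 - b" t "\<bar>x\<bar>" \<nu>] hbn assms
    by (simp add: has_bochner_integral_iff d_def c_def power_abs)
  have f_eq: "f n r = exp (of_real (1 - b) * Complex r pi + of_real t * exp (Complex r pi)) *
      ((- of_real x * exp (of_real \<nu> * Complex r pi)) ^ n /\<^sub>R fact n)" for n r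
  proof -
    have 1: "complex_of_real (exp (c n * r - t * exp r)) * cis (pi * c n) =
        exp (of_real (c n) * Complex r pi + of_real t * exp (Complex r pi))"
    proof -
      have "exp (Complex r pi) = - of_real (exp r)"
        by (simp add: exp_eq_polar cis_pi) 
      then have "of_real (c n) * Complex r pi + of_real t * exp (Complex r pi) = Complex (c n * r - t * exp r) (pi * c n)"
        by (simp add: complex_eq_iff)
      then show ?thesis
        by (simp add: exp_eq_polar)
    qed
    have 2: "exp (of_real (c n) * Complex r pi) = exp (of_real (1 - b) * Complex r pi) * exp (of_real \<nu> * Complex r pi) ^ n"
      by (simp add: exp_of_nat_mult[symmetric] exp_add[symmetric] c_def algebra_simps)
    have "f n r = of_real (d n) * (complex_of_real (exp (c n * r - t * exp r)) * cis (pi * c n))"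
      by (simp add: f_def)
    also have "\<dots> = of_real (d n) * exp (of_real (1 - b) * Complex r pi) * exp (of_real \<nu> * Complex r pi) ^ n * exp (of_real t * exp (Complex r pi))"
      unfolding 1 exp_add 2 by simp
    also have "\<dots> = exp (of_real (1 - b) * Complex r pi + of_real t * exp (Complex r pi)) *
      ((- of_real x * exp (of_real \<nu> * Complex r pi)) ^ n /\<^sub>R fact n)"
      unfolding exp_add power_mult_distrib by (simp add: d_def scaleR_conv_of_real divide_inverse mult_ac)
    finally show ?thesis .
  qed
  have sums_f: "(\<lambda>n. f n r) sums hankel \<nu> b x t (Complex r pi)" for r
  proof -
    have "(\<lambda>n. f n r) sums (exp (of_real (1 - b) * Complex r pi + of_real t * exp (Complex r pi)) *
          exp (- of_real x * exp (of_real \<nu> * Complex r pi)))"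
      unfolding f_eq by (intro sums_mult exp_converges)
    also have "\<dots> = hankel \<nu> b x t (Complex r pi)"
      by (simp add: hankel_def exp_add[symmetric])
    finally show ?thesis .
  qed
  have sumnr: "summable (\<lambda>n. norm (f n r))" for r
    unfolding f_eq norm_mult
    using summable_norm_exp[of "- of_real x * exp (of_real \<nu> * Complex r pi)"] by (intro summable_mult) auto
  have "(\<lambda>n. LINT r|lborel. f n r) sums (LINT r|lborel. hankel \<nu> b x t (Complex r pi))"
  proof -
    have "(LINT r|lborel. (\<Sum>n. f n r)) = (\<Sum>n. LINT r|lborel. f n r)"
      by (rule integral_suminf[OF int _ sumn]) (use sumnr in auto)
    moreover have "summable (\<lambda>n. LINT r|lborel. f n r)"
      by (rule summable_integral[OF int _ sumn]) (use sumnr in auto)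
    ultimately show ?thesis
      using sums_f by (simp add: sums_iff)
  qed
  then have "(\<lambda>n. Im (LINT r|lborel. f n r)) sums Im (LINT r|lborel. hankel \<nu> b x t (Complex r pi))"
    by (rule sums_Im)
  then have A: "(\<lambda>n. Im (LINT r|lborel. f n r) / pi) sums (Im (LINT r|lborel. hankel \<nu> b x t (Complex r pi)) / pi)"
    by (rule sums_divide)
  have "Im (LINT r|lborel. f n r) / pi = t powr (b - 1) * (wright_coeff \<nu> b n * (- (x * t powr (- \<nu>))) ^ n)" for n
  proof -
    \<comment> \<open>The imaginary part turns the phase into the sine of the reflection
      formula.\<close>
    have "Im (LINT r|lborel. f n r) / pi = d n * t powr (- c n) * (Gamma (c n) * sin (pi * c n) / pi)"
      using hb[of n] by (simp add: has_bochner_integral_iff)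
    also have "Gamma (c n) * sin (pi * c n) / pi = rGamma (b - real n * \<nu>)"
      using rGamma_reflection_real[OF pos[of n]] by (simp add: c_def)
    also have "d n * t powr (- c n) = t powr (b - 1) * ((- (x * t powr (- \<nu>))) ^ n / fact n)"
    proof -
      have "t powr (- c n) = t powr (b - 1) * (t powr (- \<nu>)) ^ n"
        using assms by (simp add: c_def powr_power powr_add[symmetric] algebra_simps)
      moreover have "(- (x * t powr (- \<nu>))) ^ n = (- x) ^ n * (t powr (- \<nu>)) ^ n"
        unfolding power_mult_distrib[symmetric] by simp
      ultimately show ?thesis by (simp add: d_def)
    qed
    finally show ?thesis by (simp add: wright_coeff_def)
  qed
  with A have B: "(\<lambda>n. t powr (b - 1) * (wright_coeff \<nu> b n * (- (x * t powr (- \<nu>))) ^ n)) sums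
      (Im (LINT r|lborel. hankel \<nu> b x t (Complex r pi)) / pi)" by simp
  have "summable (\<lambda>n. wright_coeff \<nu> b n * (- (x * t powr (- \<nu>))) ^ n)"
    using summable_wright_abs[OF assms(1-3)] by (rule summable_rabs_cancel)
  then have "(\<lambda>n. t powr (b - 1) * (wright_coeff \<nu> b n * (- (x * t powr (- \<nu>))) ^ n)) sums wright_kernel \<nu> b x t"
    unfolding wright_kernel_def Wright_eq_suminf by (intro sums_mult summable_sums)
  with B show ?thesis by (rule sums_unique2[symmetric])
qed

text \<open>Dropping the constant term replaces b by b - \<nu>, which widens the range from b < 1 to
  b < 1 + \<nu>. This covers b = 1, the parameter of the temperature profile.\<close>

lemma summable_wright:
  assumes "0 < \<nu>" "\<nu> < 1" "b < 1 + \<nu>"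
  shows "summable (\<lambda>n. wright_coeff \<nu> b n * z ^ n)"
proof -
  have "summable (\<lambda>n. wright_coeff \<nu> b (Suc n) * z ^ Suc n)"
  proof (rule summable_comparison_test)
    show "summable (\<lambda>n. \<bar>z\<bar> * \<bar>wright_coeff \<nu> (b - \<nu>) n * z ^ n\<bar>)"
      using assms by (intro summable_mult summable_wright_abs) auto
    show "\<exists>N. \<forall>n\<ge>N. norm (wright_coeff \<nu> b (Suc n) * z ^ Suc n) \<le> \<bar>z\<bar> * \<bar>wright_coeff \<nu> (b - \<nu>) n * z ^ n\<bar>"
    proof (intro exI allI impI)
      fix n
      have "wright_coeff \<nu> b (Suc n) = wright_coeff \<nu> (b - \<nu>) n / real (Suc n)"
        by (simp add: wright_coeff_def algebra_simps)
      then have "norm (wright_coeff \<nu> b (Suc n) * z ^ Suc n) = \<bar>z\<bar> * \<bar>wright_coeff \<nu> (b - \<nu>) n * z ^ n\<bar> / real (Suc n)"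
        by (simp add: abs_mult)
      also have "\<dots> \<le> \<bar>z\<bar> * \<bar>wright_coeff \<nu> (b - \<nu>) n * z ^ n\<bar> / 1"
        by (intro divide_left_mono) auto
      finally show "norm (wright_coeff \<nu> b (Suc n) * z ^ Suc n) \<le> \<bar>z\<bar> * \<bar>wright_coeff \<nu> (b - \<nu>) n * z ^ n\<bar>"
        by simp
    qed
  qed
  then show ?thesis by (subst (asm) summable_Suc_iff)
qed

section \<open>Derivatives and recurrence relations\<close>

lemma diffs_wright_coeff: "diffs (wright_coeff \<nu> b) = wright_coeff \<nu> (b - \<nu>)"
proof
  fix n
  have eq: "b - real (Suc n) * \<nu> = b - \<nu> - real n * \<nu>" by (simp add: algebra_simps)
  show "diffs (wright_coeff \<nu> b) n = wright_coeff \<nu> (b - \<nu>) n"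
    unfolding diffs_def wright_coeff_def eq by (simp del: of_nat_Suc)
qed

lemma Wright_0: "Wright 0 (- \<nu>) b = rGamma b"
  using powser_zero[of "wright_coeff \<nu> b"] by (simp add: Wright_eq_suminf) (simp add: wright_coeff_def)

lemma has_derivative_Wright:
  assumes "0 < \<nu>" "\<nu> < 1" "b < 1 + \<nu>"
  shows "((\<lambda>z. Wright z (- \<nu>) b) has_real_derivative Wright z (- \<nu>) (b - \<nu>)) (at z)"
  unfolding Wright_eq_suminf diffs_wright_coeff[symmetric]
  by (intro termdiffs_strong_converges_everywhere summable_wright assms)

text \<open>Coefficient by coefficient this is rGamma(y) = y rGamma(y + 1) at y = b - 1 - n \<nu>;
  the factor n in y is produced by z d/dz, and differentiation lowers b by \<nu>.\<close>

lemma Wright_recurrence: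
  assumes "0 < \<nu>" "\<nu> < 1" "b < 1 + \<nu>"
  shows "Wright z (- \<nu>) (b - 1) = (b - 1) * Wright z (- \<nu>) b - \<nu> * z * Wright z (- \<nu>) (b - \<nu>)"
proof -
  have 1: "(\<lambda>n. wright_coeff \<nu> b n * z ^ n) sums Wright z (- \<nu>) b"
    unfolding Wright_eq_suminf by (intro summable_sums summable_wright assms)
  have "(\<lambda>n. real n * wright_coeff \<nu> b n * z ^ (n - Suc 0)) sums Wright z (- \<nu>) (b - \<nu>)"
    unfolding Wright_eq_suminf diffs_wright_coeff[symmetric]
    by (rule diffs_equiv) (unfold diffs_wright_coeff, intro summable_wright, use assms in auto)
  \<comment> \<open>At n = 0 the truncated exponent \<open>n - Suc 0\<close> does no harm, as the
    factor \<open>real n\<close> vanishes.\<close>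
  from sums_mult[OF this, of z]
  have 2: "(\<lambda>n. real n * wright_coeff \<nu> b n * z ^ n) sums (z * Wright z (- \<nu>) (b - \<nu>))"
    by (rule sums_cong[THEN iffD1, rotated]) (case_tac n; simp)
  have "(b - 1) * (wright_coeff \<nu> b n * z ^ n) - \<nu> * (real n * wright_coeff \<nu> b n * z ^ n) =
      wright_coeff \<nu> (b - 1) n * z ^ n" for n
  proof -
    have r: "rGamma (b - 1 - real n * \<nu>) = (b - 1 - real n * \<nu>) * rGamma (b - real n * \<nu>)"
      using rGamma_plus1[of "b - 1 - real n * \<nu>"] by (simp add: algebra_simps)
    show ?thesis unfolding wright_coeff_def r by (simp add: field_simps)
  qed
  with sums_diff[OF sums_mult[OF 1, of "b - 1"] sums_mult[OF 2, of \<nu>]]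
  have "(\<lambda>n. wright_coeff \<nu> (b - 1) n * z ^ n) sums ((b - 1) * Wright z (- \<nu>) b - \<nu> * (z * Wright z (- \<nu>) (b - \<nu>)))"
    by simp
  then show ?thesis
    unfolding Wright_eq_suminf[of z \<nu> "b - 1"] by (simp add: sums_iff mult.assoc)
qed

text \<open>Euler's relation for the homogeneous function g_b: its t-derivative is g_(b-1) and its
  x-derivative is -g_(b-\<nu>).\<close>

lemma wright_kernel_recurrence:
  assumes "0 < \<nu>" "\<nu> < 1" "b < 1 + \<nu>" "0 < t"
  shows "t * wright_kernel \<nu> (b - 1) x t = (b - 1) * wright_kernel \<nu> b x t + \<nu> * x * wright_kernel \<nu> (b - \<nu>) x t"
proof -
  have 1: "t * t powr (b - 1 - 1) = t powr (b - 1)"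
    unfolding powr_diff[of t "b - 1" 1] using assms(4) by simp
  have 2: "t powr (b - \<nu> - 1) = t powr (b - 1) * t powr (- \<nu>)"
    by (simp add: powr_add[symmetric] algebra_simps)
  have "t * wright_kernel \<nu> (b - 1) x t = t powr (b - 1) * Wright (- (x * t powr (- \<nu>))) (- \<nu>) (b - 1)"
    unfolding wright_kernel_def 1[symmetric] by simp
  also have "\<dots> = (b - 1) * wright_kernel \<nu> b x t + \<nu> * x * wright_kernel \<nu> (b - \<nu>) x t"
    unfolding Wright_recurrence[OF assms(1-3)] wright_kernel_def 2 by (simp add: algebra_simps)
  finally show ?thesis .
qed

text \<open>Product and chain rule give the right-hand side of
  \<open>wright_kernel_recurrence\<close> divided by t.\<close>

lemma has_derivative_wright_kernel:
  assumes "0 < \<nu>" "\<nu> < 1" "b < 1 + \<nu>" "0 < t"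
  shows "(wright_kernel \<nu> b x has_real_derivative wright_kernel \<nu> (b - 1) x t) (at t)"
proof -
  note W = DERIV_chain2[OF has_derivative_Wright[OF assms(1-3)]]
  have "(wright_kernel \<nu> b x has_real_derivative
      (b - 1) * t powr (b - 1 - 1) * Wright (- (x * t powr (- \<nu>))) (- \<nu>) b +
      t powr (b - 1) * (Wright (- (x * t powr (- \<nu>))) (- \<nu>) (b - \<nu>) * (\<nu> * x * t powr (- \<nu> - 1)))) (at t)"
    unfolding wright_kernel_def[abs_def]
    by (rule derivative_eq_intros W refl | use assms in simp)+
  also have "(b - 1) * t powr (b - 1 - 1) * Wright (- (x * t powr (- \<nu>))) (- \<nu>) b +
      t powr (b - 1) * (Wright (- (x * t powr (- \<nu>))) (- \<nu>) (b - \<nu>) * (\<nu> * x * t powr (- \<nu> - 1))) =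
      ((b - 1) * wright_kernel \<nu> b x t + \<nu> * x * wright_kernel \<nu> (b - \<nu>) x t) / t"
  proof -
    have p: "t powr (b - 1 - 1) = t powr (b - 1) / t" "t powr (- \<nu> - 1) = t powr (- \<nu>) / t"
      unfolding powr_diff[of t "b - 1" 1] powr_diff[of t "- \<nu>" 1] using assms by simp_all
    have q: "t powr (b - \<nu> - 1) = t powr (b - 1) * t powr (- \<nu>)"
      by (simp add: powr_add[symmetric] algebra_simps)
    show ?thesis
      unfolding wright_kernel_def p q using assms(4) by (simp add: field_simps)
  qed
  also have "\<dots> = wright_kernel \<nu> (b - 1) x t"
    using wright_kernel_recurrence[OF assms, of x] assms(4) by (simp add: field_simps)
  finally show ?thesis .
qed

section \<open>The inversion integral on the imaginary axis\<close>

lemma Complex_exp: "exp (Complex r \<theta>) = Complex (exp r * cos \<theta>) (exp r * sin \<theta>)"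
  by (simp add: exp_eq_polar complex_eq_iff)

lemma norm_hankel:
  "norm (hankel \<nu> b x t (Complex r \<theta>)) =
     exp ((1 - b) * r + t * exp r * cos \<theta> - x * exp (\<nu> * r) * cos (\<nu> * \<theta>))"
proof -
  have "of_real \<nu> * Complex r \<theta> = Complex (\<nu> * r) (\<nu> * \<theta>)" by (simp add: complex_eq_iff)
  then show ?thesis
    by (simp add: hankel_def Complex_exp)
qed

text \<open>One estimate for both quadrants of the upper half plane:
  \<open>t * cos \<theta> \<le> 0\<close> bounds the time factor by 1, and cos(\<nu> \<theta>) is
  smallest at \<theta> = \<pi>. The first quadrant goes with t \<le> 0, the second with t >
  0.\<close>

lemma norm_hankel_le:
  assumes "0 \<le> x" "0 < \<nu>" "0 \<le> \<theta>" "\<theta> \<le> pi" "\<nu> < 1" "t * cos \<theta> \<le> 0"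
  shows "norm (hankel \<nu> b x t (Complex r \<theta>)) \<le> envelope (1 - b) (x * cos (\<nu> * pi)) \<nu> r"
proof -
  have "t * exp r * cos \<theta> \<le> 0"
    using mult_nonneg_nonpos[of "exp r" "t * cos \<theta>"] assms(6) by (simp add: mult_ac)
  moreover have "\<nu> * \<theta> \<le> \<nu> * pi" "\<nu> * pi \<le> 1 * pi"
    using assms by (intro mult_left_mono mult_right_mono; simp)+
  then have "cos (\<nu> * pi) \<le> cos (\<nu> * \<theta>)"
    using assms by (intro cos_monotone_0_pi_le) auto
  then have "(x * exp (\<nu> * r)) * cos (\<nu> * pi) \<le> (x * exp (\<nu> * r)) * cos (\<nu> * \<theta>)"
    using assms by (intro mult_left_mono) auto
  ultimately show ?thesis
    unfolding norm_hankel envelope_def by (simp add: mult_ac)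
qed

lemma hankel_holomorphic: "hankel \<nu> b x t holomorphic_on UNIV"
  unfolding hankel_def by (intro holomorphic_intros)

lemma hankel_measurable [measurable]: "(\<lambda>r. hankel \<nu> b x t (Complex r \<theta>)) \<in> borel_measurable borel"
proof -
  have "(\<lambda>r. hankel \<nu> b x t (Complex r \<theta>)) = (\<lambda>r. hankel \<nu> b x t (of_real r + \<i> * of_real \<theta>))"
    by (intro ext arg_cong[of _ _ "hankel \<nu> b x t"]) (simp add: complex_eq_iff)
  then show ?thesis unfolding hankel_def by simp
qed

text \<open>The integrand on the positive imaginary axis of \<sigma> = exp w. There t enters only
  through a factor of modulus 1, so every real t is admissible.\<close>

definition hankel_line :: "real \<Rightarrow> real \<Rightarrow> real \<Rightarrow> real \<Rightarrow> real \<Rightarrow> complex" where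
  "hankel_line \<nu> b x t r = hankel \<nu> b x t (Complex r (pi / 2))"

lemma hankel_line_time:
  "hankel_line \<nu> b x t r = hankel_line \<nu> b x 0 r * exp (\<i> * of_real (t * exp r))"
proof -
  have "exp (Complex r (pi / 2)) = \<i> * of_real (exp r)"
    by (simp add: Complex_exp complex_eq_iff)
  then show ?thesis
    by (simp add: hankel_line_def hankel_def exp_add[symmetric] algebra_simps)
qed

text \<open>After u = exp r the factor \<omega> is absorbed by adding \<open>Ln \<omega>\<close> to
  r, which lands on the horizontal line at height arg \<omega>. The line can be moved to the real
  axis because \<open>0 < Re \<omega>\<close> keeps the cosine positive in between.\<close>

lemma Gamma_integral_complex_scale:
  fixes \<beta> :: real and \<omega> :: complex
  assumes "0 < \<beta>" "0 < Re \<omega>" "0 \<le> Im \<omega>"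
  shows "(LINT u:{0<..}|lborel. of_real (u powr (\<beta> - 1)) * exp (- (of_real u * \<omega>))) =
           of_real (Gamma \<beta>) * exp (- of_real \<beta> * Ln \<omega>)"
    and "set_integrable lborel {0<..} (\<lambda>u. of_real (u powr (\<beta> - 1)) * exp (- (of_real u * \<omega>)))"
proof -
  define \<theta> where "\<theta> = Im (Ln \<omega>)"
  define \<Psi> where "\<Psi> w = exp (of_real \<beta> * w - exp w)" for w :: complex
  have \<omega>0: "\<omega> \<noteq> 0" using assms by auto
  have \<theta>: "0 \<le> \<theta>" "\<theta> < pi / 2"
    using assms Im_Ln_pos_le[OF \<omega>0] Re_Ln_pos_lt[OF \<omega>0] by (auto simp: \<theta>_def)
  then have cos_pos: "0 < cos \<theta>" by (intro cos_gt_zero_pi) auto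
  have norm_\<Psi>: "norm (\<Psi> (Complex r \<theta>')) = envelope \<beta> (cos \<theta>') 1 r" for r \<theta>'
    by (simp add: \<Psi>_def envelope_def Complex_exp mult.commute)
  have "(LINT r|lborel. \<Psi> (Complex r 0)) = (LINT r|lborel. \<Psi> (Complex r \<theta>))"
  proof (rule integral_horizontal_line_shift[where c = \<beta> and a = "cos \<theta>" and \<kappa> = 1])
    fix r \<theta>' assume "\<theta>' \<in> {0..\<theta>}"
    then have "cos \<theta> \<le> cos \<theta>'" using \<theta> by (intro cos_monotone_0_pi_le) auto
    then show "norm (\<Psi> (Complex r \<theta>')) \<le> envelope \<beta> (cos \<theta>) 1 r"
      unfolding norm_\<Psi> by (simp add: envelope_def)
  qed (use assms \<theta> cos_pos in \<open>auto simp: \<Psi>_def intro!: holomorphic_intros\<close>)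
  moreover have "\<Psi> (Complex r 0) = complex_of_real (exp (\<beta> * r - 1 * exp r))" for r
  proof -
    have "Complex r 0 = of_real r" by (simp add: complex_eq_iff)
    then show ?thesis by (simp add: \<Psi>_def exp_of_real[symmetric])
  qed
  ultimately have int_\<theta>: "(LINT r|lborel. \<Psi> (Complex r \<theta>)) = of_real (Gamma \<beta>)"
    using Gamma_integral_log[of \<beta> 1] assms
    by (simp add: has_bochner_integral_iff integral_complex_of_real del: of_real_exp)
  have meas: "(\<lambda>r. \<Psi> (Complex r \<theta>)) \<in> borel_measurable borel"
  proof -
    have "(\<lambda>r. \<Psi> (Complex r \<theta>)) = (\<lambda>r. \<Psi> (of_real r + \<i> * of_real \<theta>))"
      by (intro ext arg_cong[of _ _ \<Psi>]) (simp add: complex_eq_iff)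
    then show ?thesis unfolding \<Psi>_def by simp
  qed
  have "integrable lborel (\<lambda>r. \<Psi> (Complex r \<theta>))"
  proof (rule Bochner_Integration.integrable_bound[OF integrable_envelope])
    show "AE r in lborel. norm (\<Psi> (Complex r \<theta>)) \<le> norm (envelope \<beta> (cos \<theta>) 1 r)"
      by (simp add: norm_\<Psi>)
  qed (use assms cos_pos meas in auto)
  from lborel_integrable_real_affine[OF this, of 1 "Re (Ln \<omega>)"]
  have shifted: "integrable lborel (\<lambda>r. \<Psi> (Complex (Re (Ln \<omega>) + r) \<theta>))" by simp
  define f where "f u = of_real (u powr (\<beta> - 1)) * exp (- (of_real u * \<omega>))" for u :: real
  have [measurable]: "f \<in> borel_measurable borel" unfolding f_def by measurable
  have f_eq: "exp r *\<^sub>R f (exp r) = exp (- of_real \<beta> * Ln \<omega>) * \<Psi> (Complex (Re (Ln \<omega>) + r) \<theta>)" for r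
  proof -
    have 1: "Complex (Re (Ln \<omega>) + r) \<theta> = Ln \<omega> + of_real r"
      by (simp add: complex_eq_iff \<theta>_def)
    have 2: "exp (Ln \<omega> + of_real r) = \<omega> * of_real (exp r)"
      using \<omega>0 by (simp add: exp_add exp_of_real)
    have "exp r * exp r powr (\<beta> - 1) = exp (\<beta> * r)"
      by (simp add: powr_def exp_add[symmetric] algebra_simps)
    then have "exp r *\<^sub>R f (exp r) = of_real (exp (\<beta> * r)) * exp (- (of_real (exp r) * \<omega>))"
      by (simp add: f_def scaleR_conv_of_real mult.assoc[symmetric] of_real_mult[symmetric] del: of_real_mult)
    also have "\<dots> = exp (of_real \<beta> * of_real r - \<omega> * of_real (exp r))"
      by (simp add: exp_of_real[symmetric] exp_add[symmetric] mult.commute)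
    also have "\<dots> = exp (- of_real \<beta> * Ln \<omega>) * \<Psi> (Ln \<omega> + of_real r)"
      unfolding \<Psi>_def 2 by (simp add: exp_add[symmetric] algebra_simps)
    finally show ?thesis unfolding 1 .
  qed
  have int: "integrable lborel (\<lambda>r. exp r *\<^sub>R f (exp r))"
    unfolding f_eq using shifted by (rule integrable_mult_right)
  then show si: "set_integrable lborel {0<..} (\<lambda>u. of_real (u powr (\<beta> - 1)) * exp (- (of_real u * \<omega>)))"
    using integral_exp_substitution(1)[of f] by (simp add: f_def[abs_def])
  have "(LINT u:{0<..}|lborel. f u) = (LINT r|lborel. exp r *\<^sub>R f (exp r))"
    using si by (intro integral_exp_substitution(2)) (auto simp: f_def[abs_def])
  also have "\<dots> = exp (- of_real \<beta> * Ln \<omega>) * (LINT r|lborel. \<Psi> (Complex (Re (Ln \<omega>) + r) \<theta>))"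
    unfolding f_eq by simp
  also have "(LINT r|lborel. \<Psi> (Complex (Re (Ln \<omega>) + r) \<theta>)) = of_real (Gamma \<beta>)"
    using lborel_integral_real_affine[of 1 "\<lambda>r. \<Psi> (Complex r \<theta>)" "Re (Ln \<omega>)"] int_\<theta> by simp
  finally show "(LINT u:{0<..}|lborel. of_real (u powr (\<beta> - 1)) * exp (- (of_real u * \<omega>))) =
           of_real (Gamma \<beta>) * exp (- of_real \<beta> * Ln \<omega>)"
    by (simp add: f_def mult.commute)
qed

lemma norm_hankel_line_time: "norm (hankel_line \<nu> b x t r) = norm (hankel_line \<nu> b x 0 r)"
  by (subst hankel_line_time) (simp add: norm_mult)

lemma hankel_line_measurable [measurable]: "hankel_line \<nu> b x t \<in> borel_measurable borel"
  unfolding hankel_line_def by simp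

lemma hankel_line_measurable_pair [measurable]:
  "(\<lambda>p. hankel_line \<nu> b x (fst p) (snd p)) \<in> borel_measurable (borel \<Otimes>\<^sub>M borel)"
  by (subst hankel_line_time) measurable

text \<open>\<open>Complex r (pi / 2)\<close> is the principal logarithm of \<sigma> = i exp r, so
  the extra factor is \<sigma>^(-\<beta>) and adds \<beta> to b.\<close>

lemma hankel_line_shift_exponent:
  "hankel_line \<nu> b x t r * exp (- (of_real \<beta> * Ln (\<i> * of_real (exp r)))) = hankel_line \<nu> (b + \<beta>) x t r"
proof -
  have "\<i> * of_real (exp r) = exp (Complex r (pi / 2))"
    by (simp add: Complex_exp complex_eq_iff)
  then have Ln: "Ln (\<i> * of_real (exp r)) = Complex r (pi / 2)"
    using pi_gt_zero by (simp only: Ln_exp) (subst Ln_exp, auto)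
  show ?thesis
    unfolding Ln by (simp add: hankel_line_def hankel_def exp_add[symmetric] algebra_simps)
qed

section \<open>The kernel extended to all real times\<close>

text \<open>In the application \<nu> is \<alpha>/2. The bound \<nu> < 1/2 gives cos(\<nu> \<pi>) >
  0, so for x > 0 the factor exp(-x \<sigma>^\<nu>) decays on every ray of the closed upper half
  plane.\<close>

locale half_order =
  fixes \<nu> :: real
  assumes \<nu>: "0 < \<nu>" "\<nu> < 1 / 2"
begin

lemma cos_nu_pos: "0 < cos (\<nu> * pi)"
  using \<nu> by (intro cos_gt_zero) auto

lemma norm_hankel_line_le:
  assumes "0 \<le> x"
  shows "norm (hankel_line \<nu> b x t r) \<le> envelope (1 - b) (x * cos (\<nu> * pi)) \<nu> r"
  unfolding hankel_line_def using assms \<nu> by (intro norm_hankel_le) auto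

lemma integrable_hankel_line:
  assumes "b < 1" "0 < x"
  shows "integrable lborel (hankel_line \<nu> b x t)"
proof (rule Bochner_Integration.integrable_bound[OF integrable_envelope])
  show "AE r in lborel. norm (hankel_line \<nu> b x t r) \<le> norm (envelope (1 - b) (x * cos (\<nu> * pi)) \<nu> r)"
    using norm_hankel_line_le[of x b t] assms(2) by (auto intro: order_trans simp: less_imp_le[OF envelope_pos])
  show "hankel_line \<nu> b x t \<in> borel_measurable lborel" unfolding hankel_line_def by simp
qed (use assms \<nu> cos_nu_pos in auto)

text \<open>The inversion integral along the whole imaginary axis: the lower half contributes minus
  the complex conjugate of the upper half, and the sum divided by 2 \<pi> i is the imaginary part
  over \<pi>.\<close>

definition kernel_ext :: "real \<Rightarrow> real \<Rightarrow> real \<Rightarrow> real" where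
  "kernel_ext b x t = Im (LINT r|lborel. hankel_line \<nu> b x t r) / pi"

text \<open>For t > 0 the contour turns through the second quadrant onto the negative axis, where
  the integral is already known to be the series.\<close>

lemma kernel_ext_pos:
  assumes "b < 1" "0 < x" "0 < t"
  shows "kernel_ext b x t = wright_kernel \<nu> b x t"
proof -
  have "(LINT r|lborel. hankel \<nu> b x t (Complex r (pi / 2))) = (LINT r|lborel. hankel \<nu> b x t (Complex r pi))"
  proof (rule integral_horizontal_line_shift[OF hankel_holomorphic])
    fix r \<theta> assume \<theta>: "\<theta> \<in> {pi / 2..pi}"
    then have "cos \<theta> \<le> cos (pi / 2)"
      by (intro cos_monotone_0_pi_le) auto
    then have "t * cos \<theta> \<le> 0" using assms by (simp add: mult_nonneg_nonpos)
    then show "norm (hankel \<nu> b x t (Complex r \<theta>)) \<le> envelope (1 - b) (x * cos (\<nu> * pi)) \<nu> r"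
      using \<theta> assms \<nu> pi_ge_zero by (intro norm_hankel_le) (auto intro: order_trans[of _ "pi / 2"])
  qed (use assms \<nu> cos_nu_pos in auto)
  then show ?thesis
    using assms \<nu> by (simp add: kernel_ext_def hankel_line_def wright_kernel_eq_integral_pi)
qed

text \<open>For t \<le> 0 the contour turns the other way, onto the positive axis, where the
  integrand is real.\<close>

lemma kernel_ext_nonpos:
  assumes "b < 1" "0 < x" "t \<le> 0"
  shows "kernel_ext b x t = 0"
proof -
  have "(LINT r|lborel. hankel \<nu> b x t (Complex r 0)) = (LINT r|lborel. hankel \<nu> b x t (Complex r (pi / 2)))"
  proof (rule integral_horizontal_line_shift[OF hankel_holomorphic])
    fix r \<theta> assume \<theta>: "\<theta> \<in> {0..pi / 2}"
    then have "0 \<le> cos \<theta>" by (intro cos_ge_zero) auto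
    then have "t * cos \<theta> \<le> 0" using assms by (simp add: mult_nonpos_nonneg)
    then show "norm (hankel \<nu> b x t (Complex r \<theta>)) \<le> envelope (1 - b) (x * cos (\<nu> * pi)) \<nu> r"
      using \<theta> assms \<nu> pi_ge_zero by (intro norm_hankel_le) auto
  qed (use assms \<nu> cos_nu_pos in auto)
  moreover have "(LINT r|lborel. hankel \<nu> b x t (Complex r 0)) =
      (LINT r|lborel. complex_of_real (exp ((1 - b) * r + t * exp r - x * exp (\<nu> * r))))"
  proof (intro Bochner_Integration.integral_cong refl)
    fix r
    have "Complex r 0 = of_real r" by (simp add: complex_eq_iff)
    then show "hankel \<nu> b x t (Complex r 0) = complex_of_real (exp ((1 - b) * r + t * exp r - x * exp (\<nu> * r)))"
      by (simp add: hankel_def exp_of_real[symmetric])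
  qed
  then have "Im (LINT r|lborel. hankel \<nu> b x t (Complex r 0)) = 0"
    unfolding integral_complex_of_real by simp
  ultimately show ?thesis
    unfolding kernel_ext_def hankel_line_def by simp
qed

lemma kernel_ext_bounded:
  assumes "b < 1" "0 < x"
  obtains C where "\<And>t. \<bar>kernel_ext b x t\<bar> \<le> C"
proof (rule that)
  fix t
  let ?e = "envelope (1 - b) (x * cos (\<nu> * pi)) \<nu>"
  have int: "integrable lborel ?e" using assms \<nu> cos_nu_pos by (intro integrable_envelope) auto
  have "\<bar>Im (LINT r|lborel. hankel_line \<nu> b x t r)\<bar> \<le> norm (LINT r|lborel. hankel_line \<nu> b x t r)"
    by (rule abs_Im_le_cmod)
  also have "\<dots> \<le> (LINT r|lborel. norm (hankel_line \<nu> b x t r))"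
    by (rule integral_norm_bound)
  also have "\<dots> \<le> (LINT r|lborel. ?e r)"
    using integrable_hankel_line[OF assms] norm_hankel_line_le assms by (intro integral_mono int) auto
  finally show "\<bar>kernel_ext b x t\<bar> \<le> (LINT r|lborel. ?e r) / pi"
    by (simp add: kernel_ext_def divide_right_mono abs_divide)
qed

text \<open>The extended kernel vanishes at t = 0, and passing from time 0 to t changes the
  integrand by at most t exp r times its modulus; the extra exp r raises the first envelope
  parameter by 1.\<close>

lemma wright_kernel_linear_bound:
  assumes "b < 1" "0 < x"
  obtains C where "\<And>t. 0 < t \<Longrightarrow> \<bar>wright_kernel \<nu> b x t\<bar> \<le> C * t"
proof (rule that)
  fix t :: real assume t: "0 < t"
  let ?e = "envelope (1 - b + 1) (x * cos (\<nu> * pi)) \<nu>"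
  have int: "integrable lborel ?e" using assms \<nu> cos_nu_pos by (intro integrable_envelope) auto
  have diff: "norm (hankel_line \<nu> b x t r - hankel_line \<nu> b x 0 r) \<le> t * ?e r" for r
  proof -
    have "hankel_line \<nu> b x t r - hankel_line \<nu> b x 0 r = hankel_line \<nu> b x 0 r * (exp (\<i> * of_real (t * exp r)) - 1)"
      by (subst hankel_line_time) (simp add: algebra_simps)
    then have "norm (hankel_line \<nu> b x t r - hankel_line \<nu> b x 0 r) =
        norm (hankel_line \<nu> b x 0 r) * norm (exp (\<i> * of_real (t * exp r)) - 1)"
      by (simp add: norm_mult)
    also have "norm (exp (\<i> * of_real (t * exp r)) - 1) \<le> t * exp r"
      unfolding dist_exp_i_1 using abs_sin_x_le_abs_x[of "t * exp r / 2"] t by simp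
    then have "norm (hankel_line \<nu> b x 0 r) * norm (exp (\<i> * of_real (t * exp r)) - 1) \<le>
        envelope (1 - b) (x * cos (\<nu> * pi)) \<nu> r * (t * exp r)"
      using norm_hankel_line_le[of x b 0 r] assms by (intro mult_mono) (auto intro: less_imp_le[OF envelope_pos])
    also have "\<dots> = t * ?e r"
      by (simp add: envelope_def exp_add[symmetric] algebra_simps)
    finally show ?thesis .
  qed
  have "wright_kernel \<nu> b x t = kernel_ext b x t - kernel_ext b x 0"
    using assms t by (simp add: kernel_ext_pos kernel_ext_nonpos)
  also have "\<dots> = Im (LINT r|lborel. hankel_line \<nu> b x t r - hankel_line \<nu> b x 0 r) / pi"
    using integrable_hankel_line[OF assms] by (simp add: kernel_ext_def diff_divide_distrib)
  finally have "\<bar>wright_kernel \<nu> b x t\<bar> = \<bar>Im (LINT r|lborel. hankel_line \<nu> b x t r - hankel_line \<nu> b x 0 r)\<bar> / pi"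
    by simp
  also have "\<bar>Im (LINT r|lborel. hankel_line \<nu> b x t r - hankel_line \<nu> b x 0 r)\<bar> \<le>
      norm (LINT r|lborel. hankel_line \<nu> b x t r - hankel_line \<nu> b x 0 r)"
    by (rule abs_Im_le_cmod)
  also have "\<dots> \<le> (LINT r|lborel. norm (hankel_line \<nu> b x t r - hankel_line \<nu> b x 0 r))"
    by (rule integral_norm_bound)
  also have "\<dots> \<le> (LINT r|lborel. t * ?e r)"
    using integrable_hankel_line[OF assms] diff by (intro integral_mono int integrable_mult_right) auto
  finally show "\<bar>wright_kernel \<nu> b x t\<bar> \<le> (LINT r|lborel. ?e r) / pi * t"
    by (simp add: divide_right_mono mult.commute)
qed

section \<open>Fractional integration of the kernels\<close>

lemma kernel_ext_measurable [measurable]: "kernel_ext b x \<in> borel_measurable borel"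
proof -
  have "(\<lambda>t. LINT r|lborel. hankel_line \<nu> b x t r) \<in> borel_measurable borel"
    using hankel_line_measurable_pair[of \<nu> b x]
    by (intro lborel.borel_measurable_lebesgue_integral) (simp add: split_beta')
  then show ?thesis unfolding kernel_ext_def[abs_def] by measurable
qed

text \<open>The damping exp(-\<epsilon> u) makes the weight integrable on the half line, so Fubini
  applies. The inner integral over u is the Gamma integral with the complex scale \<epsilon> + i exp
  r.\<close>

lemma damped_fractional_integral:
  assumes "b < 1" "0 < x" "0 < \<beta>" "0 < \<epsilon>"
  shows "(LINT u:{0<..}|lborel. u powr (\<beta> - 1) * exp (- (\<epsilon> * u)) * kernel_ext b x (t - u)) =
    Im (LINT r|lborel. hankel_line \<nu> b x t r * (of_real (Gamma \<beta>) *
          exp (- (of_real \<beta> * Ln (of_real \<epsilon> + \<i> * of_real (exp r)))))) / pi"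
proof -
  define k where "k u = indicator {0<..} u * (u powr (\<beta> - 1) * exp (- (\<epsilon> * u)))" for u :: real
  have [measurable]: "k \<in> borel_measurable borel" unfolding k_def by measurable
  have k_nonneg: "0 \<le> k u" for u by (simp add: k_def)
  define F where "F u r = of_real (k u) * hankel_line \<nu> b x (t - u) r" for u r
  have k_int: "integrable lborel k"
  proof -
    have "set_integrable lborel {0<..} (\<lambda>u. complex_of_real (u powr (\<beta> - 1)) * exp (- (of_real u * of_real \<epsilon>)))"
      using assms by (intro Gamma_integral_complex_scale(2)) auto
    then have "integrable lborel (\<lambda>u. complex_of_real (k u))"
      unfolding set_integrable_def
      by (rule Bochner_Integration.integrable_cong[THEN iffD1, rotated 2])
         (auto simp: k_def scaleR_conv_of_real exp_of_real[symmetric] mult.commute split: split_indicator)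
    then show ?thesis by (simp add: complex_of_real_integrable_eq)
  qed
  have norm_F: "norm (F u r) = k u * norm (hankel_line \<nu> b x 0 r)" for u r
    using k_nonneg by (simp add: F_def norm_mult norm_hankel_line_time[of \<nu> b x "t - u"])
  have F_meas: "(\<lambda>p. F (fst p) (snd p)) \<in> borel_measurable (lborel \<Otimes>\<^sub>M lborel)"
  proof -
    have "(\<lambda>p. hankel_line \<nu> b x (t - fst p) (snd p)) \<in> borel_measurable (borel \<Otimes>\<^sub>M borel)"
      by (rule measurable_compose[OF _ hankel_line_measurable_pair, of "\<lambda>p. (t - fst p, snd p)", simplified]) measurable
    then show ?thesis unfolding F_def by measurable
  qed
  have F_int: "integrable (lborel \<Otimes>\<^sub>M lborel) (case_prod F)"
  proof (rule lborel_pair.Fubini_integrable)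
    show "case_prod F \<in> borel_measurable (lborel \<Otimes>\<^sub>M lborel)" using F_meas by (simp add: split_beta')
    show "integrable lborel (\<lambda>u. LINT r|lborel. norm (case_prod F (u, r)))"
      using k_int by (simp add: norm_F)
    show "AE u in lborel. integrable lborel (\<lambda>r. case_prod F (u, r))"
      using integrable_hankel_line[OF assms(1,2)] by (simp add: F_def)
  qed
  have "(LINT u:{0<..}|lborel. u powr (\<beta> - 1) * exp (- (\<epsilon> * u)) * kernel_ext b x (t - u)) =
      (LINT u|lborel. Im (LINT r|lborel. F u r) / pi)"
    unfolding set_lebesgue_integral_def
    by (intro Bochner_Integration.integral_cong refl) (simp add: F_def kernel_ext_def k_def split: split_indicator)
  also have "\<dots> = Im (LINT u|lborel. (LINT r|lborel. F u r)) / pi"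
    using lborel_pair.integrable_fst[OF F_int] by simp
  also have "(LINT u|lborel. (LINT r|lborel. F u r)) = (LINT r|lborel. (LINT u|lborel. F u r))"
    using lborel_pair.Fubini_integral[OF F_int] by simp
  also have "\<dots> = (LINT r|lborel. hankel_line \<nu> b x t r * (of_real (Gamma \<beta>) *
          exp (- (of_real \<beta> * Ln (of_real \<epsilon> + \<i> * of_real (exp r))))))"
  proof (intro Bochner_Integration.integral_cong refl)
    fix r
    define \<omega> where "\<omega> = of_real \<epsilon> + \<i> * of_real (exp r)"
    have "F u r = hankel_line \<nu> b x t r * (indicator {0<..} u *\<^sub>R (of_real (u powr (\<beta> - 1)) * exp (- (of_real u * \<omega>))))" for u
    proof -
      have "exp (- (of_real u * \<omega>)) = exp (- (\<i> * of_real (u * exp r))) * of_real (exp (- (\<epsilon> * u)))"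
        by (simp add: \<omega>_def exp_of_real[symmetric] exp_add[symmetric] algebra_simps)
      moreover have "hankel_line \<nu> b x (t - u) r = hankel_line \<nu> b x t r * exp (- (\<i> * of_real (u * exp r)))"
        by (subst (1 2) hankel_line_time) (simp add: exp_add[symmetric] algebra_simps)
      ultimately show ?thesis
        by (simp add: F_def k_def split: split_indicator)
    qed
    then have "(LINT u|lborel. F u r) = hankel_line \<nu> b x t r *
        (LINT u:{0<..}|lborel. of_real (u powr (\<beta> - 1)) * exp (- (of_real u * \<omega>)))"
      by (simp only: set_lebesgue_integral_def integral_mult_right_zero)
    also have "(LINT u:{0<..}|lborel. of_real (u powr (\<beta> - 1)) * exp (- (of_real u * \<omega>))) =
        of_real (Gamma \<beta>) * exp (- (of_real \<beta> * Ln \<omega>))"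
      using Gamma_integral_complex_scale(1)[of \<beta> \<omega>] assms by (simp add: \<omega>_def)
    finally show "(LINT u|lborel. F u r) = hankel_line \<nu> b x t r * (of_real (Gamma \<beta>) *
          exp (- (of_real \<beta> * Ln (of_real \<epsilon> + \<i> * of_real (exp r)))))"
      by (simp add: \<omega>_def)
  qed
  finally show ?thesis .
qed

text \<open>The damped identity is passed to the limit \<epsilon> = 0. On the left the vanishing of
  \<open>kernel_ext\<close> at nonpositive times cuts the half line down to (0,t); on the right
  \<open>hankel_line_shift_exponent\<close> identifies the limit.\<close>

lemma fractional_integral_kernel_ext:
  assumes "0 < x" "0 < \<beta>" "b + \<beta> < 1" "0 < t"
  shows "set_integrable lborel {0<..<t} (\<lambda>u. u powr (\<beta> - 1) * kernel_ext b x (t - u))"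
    and "(LINT u:{0<..<t}|lborel. u powr (\<beta> - 1) * kernel_ext b x (t - u)) = Gamma \<beta> * kernel_ext (b + \<beta>) x t"
proof -
  have b: "b < 1" using assms by simp
  obtain C where C: "\<And>t. \<bar>kernel_ext b x t\<bar> \<le> C"
    using kernel_ext_bounded[OF b \<open>0 < x\<close>] by blast
  have C0: "0 \<le> C" using C[of 0] by linarith
  have dom: "integrable lborel (\<lambda>u. indicator {0<..<t} u * u powr (\<beta> - 1) * C)"
  proof -
    have "(\<lambda>u. u powr (\<beta> - 1)) integrable_on {0..t}"
      using integrable_on_powr_from_0[of "\<beta> - 1" t] assms by simp
    then have "(\<lambda>u. u powr (\<beta> - 1)) absolutely_integrable_on {0..t}"
      by (subst absolutely_integrable_on_iff_nonneg) auto
    then have "(\<lambda>u. u powr (\<beta> - 1)) absolutely_integrable_on {0<..<t}"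
      by (rule set_integrable_subset) auto
    then have "integrable lborel (\<lambda>u. indicator {0<..<t} u * u powr (\<beta> - 1))"
      unfolding set_integrable_def by (subst (asm) integrable_completion) auto
    then show ?thesis by simp
  qed
  \<comment> \<open>The factor \<open>e\<close> stands for 1 or for the damping, which is at most 1
    only when u \<ge> 0; for u \<le> 0 the indicator is 0.\<close>
  have bound: "norm (indicator {0<..} u *\<^sub>R (u powr (\<beta> - 1) * e * kernel_ext b x (t - u)))
      \<le> indicator {0<..<t} u * u powr (\<beta> - 1) * C" if "0 \<le> e" "e \<le> 1 \<or> u \<le> 0" for u e
  proof (cases "0 < u \<and> u < t")
    case True
    have "u powr (\<beta> - 1) * e * \<bar>kernel_ext b x (t - u)\<bar> \<le> u powr (\<beta> - 1) * 1 * C"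
      using that True C C0 by (intro mult_mono) auto
    then show ?thesis using True that by (simp add: abs_mult)
  next
    case False
    then show ?thesis
      using kernel_ext_nonpos[OF b \<open>0 < x\<close>, of "t - u"] by (cases "0 < u") auto
  qed
  show si: "set_integrable lborel {0<..<t} (\<lambda>u. u powr (\<beta> - 1) * kernel_ext b x (t - u))"
    unfolding set_integrable_def
  proof (rule Bochner_Integration.integrable_bound[OF dom])
    show "AE u in lborel. norm (indicator {0<..<t} u *\<^sub>R (u powr (\<beta> - 1) * kernel_ext b x (t - u)))
        \<le> norm (indicator {0<..<t} u * u powr (\<beta> - 1) * C)"
    proof (rule AE_I2)
      fix u
      show "norm (indicator {0<..<t} u *\<^sub>R (u powr (\<beta> - 1) * kernel_ext b x (t - u)))
        \<le> norm (indicator {0<..<t} u * u powr (\<beta> - 1) * C)"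
        using bound[of 1 u] C0 by (auto split: split_indicator_asm split_indicator)
    qed
  qed measurable
  define H where "H \<epsilon> = (LINT u:{0<..}|lborel. u powr (\<beta> - 1) * exp (- (\<epsilon> * u)) * kernel_ext b x (t - u))" for \<epsilon>
  define \<epsilon> where "\<epsilon> n = 1 / real (Suc n)" for n
  have \<epsilon>0: "0 < \<epsilon> n" for n by (simp add: \<epsilon>_def)
  have \<epsilon>_lim: "\<epsilon> \<longlonglongrightarrow> 0" unfolding \<epsilon>_def by real_asymp
  have "(\<lambda>n. H (\<epsilon> n)) \<longlonglongrightarrow> H 0"
    unfolding H_def set_lebesgue_integral_def
  proof (rule integral_dominated_convergence[OF _ _ dom])
    show "AE u in lborel. (\<lambda>n. indicator {0<..} u *\<^sub>R (u powr (\<beta> - 1) * exp (- (\<epsilon> n * u)) * kernel_ext b x (t - u)))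
        \<longlonglongrightarrow> indicator {0<..} u *\<^sub>R (u powr (\<beta> - 1) * exp (- (0 * u)) * kernel_ext b x (t - u))"
      using \<epsilon>_lim by (intro AE_I2 tendsto_intros)
    show "AE u in lborel. norm (indicator {0<..} u *\<^sub>R (u powr (\<beta> - 1) * exp (- (\<epsilon> n * u)) * kernel_ext b x (t - u)))
        \<le> indicator {0<..<t} u * u powr (\<beta> - 1) * C" for n
      using \<epsilon>0[of n] by (intro AE_I2 bound) (auto simp: not_le)
  qed measurable
  moreover have "(\<lambda>n. H (\<epsilon> n)) \<longlonglongrightarrow> Gamma \<beta> * kernel_ext (b + \<beta>) x t"
  proof -
    define f where "f n r = hankel_line \<nu> b x t r * (of_real (Gamma \<beta>) *
          exp (- (of_real \<beta> * Ln (of_real (\<epsilon> n) + \<i> * of_real (exp r)))))" for n r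
    have "(\<lambda>n. LINT r|lborel. f n r) \<longlonglongrightarrow> (LINT r|lborel. of_real (Gamma \<beta>) * hankel_line \<nu> (b + \<beta>) x t r)"
    proof (rule integral_dominated_convergence)
      show "integrable lborel (\<lambda>r. Gamma \<beta> * envelope (1 - (b + \<beta>)) (x * cos (\<nu> * pi)) \<nu> r)"
        using assms \<nu> cos_nu_pos by (intro integrable_mult_right integrable_envelope) auto
      show "AE r in lborel. (\<lambda>n. f n r) \<longlonglongrightarrow> of_real (Gamma \<beta>) * hankel_line \<nu> (b + \<beta>) x t r"
      proof (rule AE_I2)
        fix r
        have "(\<lambda>n. of_real (\<epsilon> n) + \<i> * of_real (exp r)) \<longlonglongrightarrow> of_real 0 + \<i> * of_real (exp r)"
          by (intro tendsto_intros \<epsilon>_lim)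
        then have "(\<lambda>n. Ln (of_real (\<epsilon> n) + \<i> * of_real (exp r))) \<longlonglongrightarrow> Ln (of_real 0 + \<i> * of_real (exp r))"
          by (rule tendsto_Ln) (auto simp: complex_nonpos_Reals_iff)
        then have "(\<lambda>n. f n r) \<longlonglongrightarrow> hankel_line \<nu> b x t r * (of_real (Gamma \<beta>) *
          exp (- (of_real \<beta> * Ln (of_real 0 + \<i> * of_real (exp r)))))"
          unfolding f_def by (intro tendsto_mult tendsto_exp tendsto_minus tendsto_const)
        then show "(\<lambda>n. f n r) \<longlonglongrightarrow> of_real (Gamma \<beta>) * hankel_line \<nu> (b + \<beta>) x t r"
          unfolding hankel_line_shift_exponent[symmetric] by (simp add: mult_ac)
      qed
      show "AE r in lborel. norm (f n r) \<le> Gamma \<beta> * envelope (1 - (b + \<beta>)) (x * cos (\<nu> * pi)) \<nu> r" for n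
      proof (rule AE_I2)
        fix r
        define \<omega> where "\<omega> = of_real (\<epsilon> n) + \<i> * of_real (exp r)"
        have Im: "Im \<omega> = exp r" by (simp add: \<omega>_def)
        \<comment> \<open>This lower bound is uniform in n. It bounds the modulus of
          \<omega>^(-\<beta>) by exp(-\<beta> r), the source of b + \<beta> in the envelope.\<close>
        then have le: "exp r \<le> norm \<omega>" using abs_Im_le_cmod[of \<omega>] by simp
        have "\<omega> \<noteq> 0" using Im by (metis exp_not_eq_zero zero_complex.simps(2))
        then have "Re (Ln \<omega>) = ln (norm \<omega>)" by simp
        moreover have "r \<le> ln (norm \<omega>)" using le by (smt (verit) exp_gt_zero ln_exp ln_le_cancel_iff)
        ultimately have "norm (exp (- (of_real \<beta> * Ln \<omega>))) \<le> exp (- (\<beta> * r))"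
          using assms by simp
        then have "norm (f n r) \<le> envelope (1 - b) (x * cos (\<nu> * pi)) \<nu> r * (Gamma \<beta> * exp (- (\<beta> * r)))"
          unfolding f_def norm_mult \<omega>_def[symmetric]
          using norm_hankel_line_le[of x b t r] assms Gamma_real_pos[of \<beta>]
          by (intro mult_mono) (auto intro: less_imp_le[OF envelope_pos])
        also have "\<dots> = Gamma \<beta> * envelope (1 - (b + \<beta>)) (x * cos (\<nu> * pi)) \<nu> r"
          by (simp add: envelope_def exp_add[symmetric] algebra_simps)
        finally show "norm (f n r) \<le> Gamma \<beta> * envelope (1 - (b + \<beta>)) (x * cos (\<nu> * pi)) \<nu> r" .
      qed
    qed (auto simp: f_def)
    then have "(\<lambda>n. Im (LINT r|lborel. f n r) / pi) \<longlonglongrightarrow> Im (LINT r|lborel. of_real (Gamma \<beta>) * hankel_line \<nu> (b + \<beta>) x t r) / pi"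
      by (intro tendsto_intros) auto
    moreover have "H (\<epsilon> n) = Im (LINT r|lborel. f n r) / pi" for n
      unfolding H_def f_def using damped_fractional_integral[OF b _ _ \<epsilon>0] assms by simp
    ultimately show ?thesis by (simp add: kernel_ext_def)
  qed
  ultimately have "H 0 = Gamma \<beta> * kernel_ext (b + \<beta>) x t" by (rule LIMSEQ_unique)
  moreover have "H 0 = (LINT u:{0<..<t}|lborel. u powr (\<beta> - 1) * kernel_ext b x (t - u))"
    unfolding H_def set_lebesgue_integral_def
    using kernel_ext_nonpos[OF b \<open>0 < x\<close>]
    by (intro Bochner_Integration.integral_cong) (auto split: split_indicator)
  ultimately show "(LINT u:{0<..<t}|lborel. u powr (\<beta> - 1) * kernel_ext b x (t - u)) = Gamma \<beta> * kernel_ext (b + \<beta>) x t"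
    by simp
qed

text \<open>The identity for \<open>kernel_ext\<close> reflected by u = t - \<tau>, in the shape of
  the Caputo integral of order 1 - \<beta>.\<close>

lemma fractional_integral_wright_kernel:
  assumes "0 < x" "0 < \<beta>" "b + \<beta> < 1" "0 < t"
  shows "((\<lambda>\<tau>. wright_kernel \<nu> b x \<tau> / (t - \<tau>) powr (1 - \<beta>)) has_integral
            Gamma \<beta> * wright_kernel \<nu> (b + \<beta>) x t) {0..t}"
proof -
  have b: "b < 1" using assms by simp
  define f where "f u = indicator {0<..<t} u *\<^sub>R (u powr (\<beta> - 1) * kernel_ext b x (t - u))" for u
  have f_reflect: "f (t + (- 1) * \<tau>) = indicator {0<..<t} \<tau> *\<^sub>R (wright_kernel \<nu> b x \<tau> / (t - \<tau>) powr (1 - \<beta>))" for \<tau>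
  proof (cases "\<tau> \<in> {0<..<t}")
    case True
    have "(t - \<tau>) powr (\<beta> - 1) = 1 / (t - \<tau>) powr (1 - \<beta>)"
      using powr_minus_divide[of "t - \<tau>" "1 - \<beta>"] by simp
    with True show ?thesis
      using kernel_ext_pos[OF b \<open>0 < x\<close>, of \<tau>] by (simp add: f_def)
  qed (auto simp: f_def indicator_def)
  have "integrable lborel f"
    using fractional_integral_kernel_ext(1)[OF assms] by (simp add: f_def[abs_def] set_integrable_def)
  from lborel_integrable_real_affine[OF this, of "- 1" t]
  have si: "set_integrable lborel {0<..<t} (\<lambda>\<tau>. wright_kernel \<nu> b x \<tau> / (t - \<tau>) powr (1 - \<beta>))"
    unfolding set_integrable_def f_reflect by simp
  have "(LINT u|lborel. f u) = (LINT \<tau>|lborel. f (t + (- 1) * \<tau>))"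
    using lborel_integral_real_affine[of "- 1" f t] by simp
  also have "\<dots> = integral {0<..<t} (\<lambda>\<tau>. wright_kernel \<nu> b x \<tau> / (t - \<tau>) powr (1 - \<beta>))"
    using set_borel_integral_eq_integral(2)[OF si] unfolding f_reflect set_lebesgue_integral_def by simp
  finally have "integral {0<..<t} (\<lambda>\<tau>. wright_kernel \<nu> b x \<tau> / (t - \<tau>) powr (1 - \<beta>)) = Gamma \<beta> * kernel_ext (b + \<beta>) x t"
    using fractional_integral_kernel_ext(2)[OF assms] by (simp add: f_def set_lebesgue_integral_def)
  then have "integral {0<..<t} (\<lambda>\<tau>. wright_kernel \<nu> b x \<tau> / (t - \<tau>) powr (1 - \<beta>)) = Gamma \<beta> * wright_kernel \<nu> (b + \<beta>) x t"
    using kernel_ext_pos[OF _ \<open>0 < x\<close> \<open>0 < t\<close>] assms by simp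
  then show "((\<lambda>\<tau>. wright_kernel \<nu> b x \<tau> / (t - \<tau>) powr (1 - \<beta>)) has_integral
            Gamma \<beta> * wright_kernel \<nu> (b + \<beta>) x t) {0..t}"
    using integrable_integral[OF set_borel_integral_eq_integral(1)[OF si]]
    unfolding has_integral_Icc_iff_Ioo by simp
qed

section \<open>Positivity and monotonicity of the Mainardi function\<close>

text \<open>The function G of the minimum argument, the inverse Laplace transform of s^(\<nu>-1)
  exp(-s^\<nu>). Fixing x = 1 loses nothing, as \<open>t powr (- \<nu>)\<close> runs through all
  positive numbers.\<close>

abbreviation mainardi_kernel :: "real \<Rightarrow> real" where
  "mainardi_kernel \<equiv> wright_kernel \<nu> (1 - \<nu>) 1"

lemma mainardi_kernel_eq: "0 < t \<Longrightarrow> mainardi_kernel t = t powr (- \<nu>) * Mainardi \<nu> (t powr (- \<nu>))"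
  by (simp add: wright_kernel_def Mainardi_def)

lemma mainardi_kernel_derivative:
  "0 < t \<Longrightarrow> (mainardi_kernel has_real_derivative wright_kernel \<nu> (- \<nu>) 1 t) (at t)"
  using has_derivative_wright_kernel[of \<nu> "1 - \<nu>" t 1] \<nu> by simp

lemma mainardi_kernel_recurrence:
  "0 < t \<Longrightarrow> t * wright_kernel \<nu> (- \<nu>) 1 t = \<nu> * wright_kernel \<nu> (1 - 2 * \<nu>) 1 t - \<nu> * mainardi_kernel t"
  using wright_kernel_recurrence[of \<nu> "1 - \<nu>" t 1] \<nu> by simp

lemma isCont_Mainardi: "isCont (Mainardi \<nu>) z"
proof -
  have "isCont (\<lambda>z. Wright (- z) (- \<nu>) (1 - \<nu>)) z"
    by (rule isCont_o2[OF _ DERIV_isCont[OF has_derivative_Wright]]) (use \<nu> in \<open>auto intro: continuous_intros\<close>)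
  then show ?thesis unfolding Mainardi_def[abs_def] by simp
qed

lemma Mainardi_0_pos: "0 < Mainardi \<nu> 0"
  using \<nu> by (simp add: Mainardi_def Wright_0 rGamma_inverse_Gamma Gamma_real_pos)

text \<open>At a point \<open>t\<^sub>0\<close> where \<open>t\<^sup>1\<^sup>-\<^sup>\<nu> G(t)\<close> attains its minimum \<open>-m\<close>, the comparison function \<open>V\<close> with
  \<open>V' \<ge> (t\<^sub>0 - \<tau>)\<^sup>-\<^sup>\<nu> G'\<close> vanishes at both ends of \<open>(0,t\<^sub>0)\<close>, as \<open>\<tau>\<^sup>\<nu>\<^sup>-\<^sup>1\<close> has vanishing fractional derivative of
  order \<open>\<nu>\<close>.\<close>
lemma mainardi_fractional_derivative_at_minimum:
  assumes T: "0 < T" and G_T: "mainardi_kernel T = - (m * T powr (\<nu> - 1))"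
    and min: "\<And>\<tau>. 0 < \<tau> \<Longrightarrow> - (m * \<tau> powr (\<nu> - 1)) \<le> mainardi_kernel \<tau>"
  shows "wright_kernel \<nu> (1 - 2 * \<nu>) 1 T \<le> 0"
proof -
  let ?G = mainardi_kernel
  let ?G' = "wright_kernel \<nu> (- \<nu>) 1"
  define f where "f \<tau> = ?G' \<tau> / (T - \<tau>) powr \<nu>" for \<tau>
  \<comment> \<open>By the product rule f = (G (T - \<tau>)^(-\<nu>))' - \<nu> (T -
    \<tau>)^(-\<nu>-1) G. Replacing G in the last term by its lower bound -m \<tau>^(\<nu>-1) leaves
    an explicit function, whose primitive is the second summand of \<open>V\<close>.\<close>
  define V where "V \<tau> = ?G \<tau> / (T - \<tau>) powr \<nu> + m / T * (\<tau> / (T - \<tau>)) powr \<nu>" for \<tau>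
  define V' where "V' \<tau> = ?G' \<tau> / (T - \<tau>) powr \<nu> + \<nu> * (T - \<tau>) powr (- \<nu> - 1) * (?G \<tau> + m * \<tau> powr (\<nu> - 1))" for \<tau>
  have f_int: "(f has_integral Gamma (1 - \<nu>) * wright_kernel \<nu> (1 - 2 * \<nu>) 1 T) {0..T}"
    using fractional_integral_wright_kernel[of 1 "1 - \<nu>" "- \<nu>" T] \<nu> T by (simp add: f_def[abs_def])
  define F where "F s = integral {0..s} f" for s
  have f_on: "f integrable_on {0..T}" using f_int by blast
  have F_cont: "continuous_on {0..T} F"
    unfolding F_def by (rule indefinite_integral_continuous_1[OF f_on])
  have V_deriv: "(V has_real_derivative V' \<tau>) (at \<tau>)" if \<tau>: "0 < \<tau>" "\<tau> < T" for \<tau>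
  proof -
    have V_eq: "V s = ?G s * (T - s) powr (- \<nu>) + m / T * (s powr \<nu> * (T - s) powr (- \<nu>))" if "s \<in> {0<..<T}" for s
    proof -
      have "(s / (T - s)) powr \<nu> = s powr \<nu> / (T - s) powr \<nu>"
        using that by (simp add: powr_divide)
      then show ?thesis by (simp add: V_def powr_minus divide_inverse)
    qed
    have "((\<lambda>s. ?G s * (T - s) powr (- \<nu>) + m / T * (s powr \<nu> * (T - s) powr (- \<nu>))) has_real_derivative
       ?G' \<tau> * (T - \<tau>) powr (- \<nu>) + ?G \<tau> * (\<nu> * (T - \<tau>) powr (- \<nu> - 1)) +
       m / T * (\<nu> * \<tau> powr (\<nu> - 1) * (T - \<tau>) powr (- \<nu>) + \<tau> powr \<nu> * (\<nu> * (T - \<tau>) powr (- \<nu> - 1)))) (at \<tau>)"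
      by (rule derivative_eq_intros mainardi_kernel_derivative refl | use \<tau> in simp)+
    also have "?G' \<tau> * (T - \<tau>) powr (- \<nu>) + ?G \<tau> * (\<nu> * (T - \<tau>) powr (- \<nu> - 1)) +
       m / T * (\<nu> * \<tau> powr (\<nu> - 1) * (T - \<tau>) powr (- \<nu>) + \<tau> powr \<nu> * (\<nu> * (T - \<tau>) powr (- \<nu> - 1))) = V' \<tau>"
    proof -
      have 1: "(T - \<tau>) powr (- \<nu>) = (T - \<tau>) * (T - \<tau>) powr (- \<nu> - 1)"
        unfolding powr_diff[of "T - \<tau>" "- \<nu>" 1] using \<tau> by simp
      have 2: "\<tau> powr \<nu> = \<tau> * \<tau> powr (\<nu> - 1)"
        unfolding powr_diff[of \<tau> \<nu> 1] using \<tau> by simp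
      \<comment> \<open>The factors T - \<tau> and \<tau> add up to T, which cancels the 1/T in
        \<open>V\<close>.\<close>
      have 3: "\<nu> * \<tau> powr (\<nu> - 1) * (T - \<tau>) powr (- \<nu>) + \<tau> powr \<nu> * (\<nu> * (T - \<tau>) powr (- \<nu> - 1)) =
         T * (\<nu> * \<tau> powr (\<nu> - 1) * (T - \<tau>) powr (- \<nu> - 1))"
        unfolding 1 2 by (simp add: algebra_simps)
      have 4: "?G' \<tau> / (T - \<tau>) powr \<nu> = ?G' \<tau> * (T - \<tau>) powr (- \<nu>)"
        by (simp add: powr_minus divide_inverse)
      show ?thesis unfolding 3 V'_def 4 using T by (simp add: algebra_simps)
    qed
    finally show ?thesis
      by (rule has_field_derivative_transform_within_open[where S = "{0<..<T}"]) (use \<tau> V_eq in auto)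
  qed
  \<comment> \<open>The comparison is made strictly inside (0,T), where \<open>V\<close> is
    differentiable; the ends are reached by limits.\<close>
  have step: "F b - F a \<le> V b - V a" if ab: "0 < a" "a \<le> b" "b < T" for a b
  proof -
    have fab: "f integrable_on {a..b}" using integrable_subinterval_real[OF f_on, of a b] ab by auto
    have "F a + integral {a..b} f = F b"
      unfolding F_def using ab integrable_subinterval_real[OF f_on, of 0 b]
      by (intro Henstock_Kurzweil_Integration.integral_combine) auto
    moreover have "(V' has_integral (V b - V a)) {a..b}"
    proof (rule fundamental_theorem_of_calculus)
      fix \<tau> assume "\<tau> \<in> {a..b}"
      then have "(V has_real_derivative V' \<tau>) (at \<tau>)" using ab by (intro V_deriv) auto
      then show "(V has_vector_derivative V' \<tau>) (at \<tau> within {a..b})"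
        by (simp add: has_real_derivative_iff_has_vector_derivative has_vector_derivative_at_within)
    qed (use ab in auto)
    then have "integral {a..b} f \<le> V b - V a"
    proof (rule has_integral_le[OF integrable_integral[OF fab]])
      fix \<tau> assume "\<tau> \<in> {a..b}"
      then have "0 \<le> \<nu> * (T - \<tau>) powr (- \<nu> - 1) * (?G \<tau> + m * \<tau> powr (\<nu> - 1))"
        using min[of \<tau>] ab \<nu> by (intro mult_nonneg_nonneg) auto
      then show "f \<tau> \<le> V' \<tau>" by (simp add: f_def V'_def)
    qed
    ultimately show ?thesis by simp
  qed
  have G_0: "(?G \<longlongrightarrow> 0) (at_right 0)"
  proof -
    obtain C where C: "\<And>t. 0 < t \<Longrightarrow> \<bar>?G t\<bar> \<le> C * t"
      using wright_kernel_linear_bound[of "1 - \<nu>" 1] \<nu> by auto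
    show ?thesis
    proof (rule Lim_null_comparison)
      show "\<forall>\<^sub>F t in at_right 0. norm (?G t) \<le> C * t"
        using C by (auto simp: eventually_at_right_less intro: eventually_mono[OF eventually_at_right_less])
      show "((\<lambda>t. C * t) \<longlongrightarrow> 0) (at_right 0)" by (auto intro!: tendsto_eq_intros)
    qed
  qed
  have V_0: "(V \<longlongrightarrow> 0) (at_right 0)"
  proof -
    have "((\<lambda>\<tau>. m / T * (\<tau> / (T - \<tau>)) powr \<nu>) \<longlongrightarrow> 0) (at_right 0)"
      using T \<nu> by real_asymp
    moreover have "((\<lambda>\<tau>. 1 / (T - \<tau>) powr \<nu>) \<longlongrightarrow> 1 / T powr \<nu>) (at_right 0)"
      using T \<nu> by (auto intro!: tendsto_eq_intros)
    ultimately show ?thesis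
      using tendsto_add[OF tendsto_mult[OF G_0, of "\<lambda>\<tau>. 1 / (T - \<tau>) powr \<nu>"]] by (simp add: V_def[abs_def])
  qed
  have V_T: "(V \<longlongrightarrow> 0) (at_left T)"
  proof -
    \<comment> \<open>\<open>V\<close> is \<open>N\<close> over (T - s)^\<nu>. The value of G at T
      makes \<open>N\<close> vanish there, and a zero of a differentiable function outweighs a
      singularity of order \<nu> < 1.\<close>
    define N where "N s = ?G s + m / T * s powr \<nu>" for s
    have "N T = 0"
      using T by (simp add: N_def G_T powr_diff)
    define D where "D = ?G' T + m / T * (\<nu> * T powr (\<nu> - 1))"
    have "(N has_real_derivative D) (at T)"
      unfolding N_def D_def
      by (rule derivative_eq_intros mainardi_kernel_derivative refl | use T in simp)+
    then have "((\<lambda>s. (N s - N T) / (s - T)) \<longlongrightarrow> D) (at_left T)"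
      by (auto simp: has_field_derivative_iff intro: tendsto_within_subset)
    moreover have "((\<lambda>s. - ((T - s) powr (1 - \<nu>))) \<longlongrightarrow> 0) (at_left T)"
      using \<nu> by real_asymp
    ultimately have lim: "((\<lambda>s. (N s - N T) / (s - T) * - ((T - s) powr (1 - \<nu>))) \<longlongrightarrow> D * 0) (at_left T)"
      by (rule tendsto_mult)
    have "\<forall>\<^sub>F s in at_left T. (N s - N T) / (s - T) * - ((T - s) powr (1 - \<nu>)) = V s"
      using eventually_at_left_real[OF T]
    proof eventually_elim
      case (elim s)
      then have s: "0 < s" "s < T" by auto
      have 1: "(T - s) powr (1 - \<nu>) = (T - s) / (T - s) powr \<nu>" using s by (simp add: powr_diff)
      have 2: "V s = N s / (T - s) powr \<nu>"
        using s by (simp add: V_def N_def powr_divide add_divide_distrib)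
      show ?case
        unfolding 1 2 \<open>N T = 0\<close> using s by (simp add: divide_simps) (simp add: algebra_simps)
    qed
    from Lim_transform_eventually[OF lim this] show ?thesis by simp
  qed
  have F_V: "F b \<le> V b" if b: "0 < b" "b < T" for b
  proof -
    have "(F \<longlongrightarrow> F 0) (at_right 0)"
      using F_cont T by (auto simp: continuous_on_Icc_at_rightD)
    from tendsto_add[OF tendsto_diff[OF tendsto_const[of "V b"] V_0] this]
    have "((\<lambda>a. V b - V a + F a) \<longlongrightarrow> V b) (at_right 0)"
      by (simp add: F_def)
    moreover have "\<forall>\<^sub>F a in at_right 0. F b \<le> V b - V a + F a"
      using eventually_at_right_real[OF b(1)]
    proof eventually_elim
      case (elim a)
      then show ?case using step[of a b] b by simp
    qed
    ultimately show ?thesis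
      by (rule tendsto_lowerbound) simp
  qed
  have "(F \<longlongrightarrow> F T) (at_left T)"
    using F_cont T by (auto simp: continuous_on_Icc_at_leftD)
  moreover have "\<forall>\<^sub>F b in at_left T. F b \<le> V b"
    using eventually_at_left_real[OF T] by eventually_elim (use F_V in auto)
  ultimately have "F T \<le> 0"
    using tendsto_le[OF _ V_T, of F "F T"] by simp
  moreover have "F T = Gamma (1 - \<nu>) * wright_kernel \<nu> (1 - 2 * \<nu>) 1 T"
    using f_int by (simp add: F_def integral_unique)
  moreover have "0 < Gamma (1 - \<nu>)"
    using \<nu> by (intro Gamma_real_pos) simp
  ultimately show ?thesis
    by (auto simp: mult_le_0_iff)
qed

text \<open>If M_\<nu> were negative somewhere, J(t) = t^(1-\<nu>) G(t) would have a negative global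
  minimum at some T > 0: it tends to 0 as t tends to 0, and M_\<nu>(0) > 0 makes it positive for
  large t. Stationarity at T then contradicts the sign of g_(1-2\<nu>) at a minimum.\<close>

lemma Mainardi_nonneg:
  assumes z: "0 < z"
  shows "0 \<le> Mainardi \<nu> z"
proof (rule ccontr)
  assume "\<not> 0 \<le> Mainardi \<nu> z"
  then have neg: "Mainardi \<nu> z < 0" by simp
  let ?G = mainardi_kernel
  define J where "J t = t powr (1 - \<nu>) * ?G t" for t
  have J_deriv: "(J has_real_derivative (1 - \<nu>) * t powr (- \<nu>) * ?G t + t powr (1 - \<nu>) * wright_kernel \<nu> (- \<nu>) 1 t) (at t)"
    if "0 < t" for t
    unfolding J_def using DERIV_mult[OF has_real_derivative_powr[OF that, of "1 - \<nu>"] mainardi_kernel_derivative[OF that]]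
    by (simp add: algebra_simps)
  define t\<^sub>0 where "t\<^sub>0 = z powr (- 1 / \<nu>)"
  have t\<^sub>0: "0 < t\<^sub>0" using z by (simp add: t\<^sub>0_def)
  have "t\<^sub>0 powr (- \<nu>) = z" using z \<nu> by (simp add: t\<^sub>0_def powr_powr)
  then have J_t\<^sub>0: "J t\<^sub>0 < 0"
    using t\<^sub>0 neg z by (simp add: J_def mainardi_kernel_eq mult_pos_neg)
  have J_0: "(J \<longlongrightarrow> 0) (at_right 0)"
  proof -
    obtain C where C: "\<And>t. 0 < t \<Longrightarrow> \<bar>?G t\<bar> \<le> C * t"
      using wright_kernel_linear_bound[of "1 - \<nu>" 1] \<nu> by auto
    show ?thesis
    proof (rule Lim_null_comparison)
      show "\<forall>\<^sub>F t in at_right 0. norm (J t) \<le> t powr (1 - \<nu>) * (C * t)"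
        using eventually_at_right_less[of 0]
      proof eventually_elim
        case (elim t)
        then show ?case using C[of t] by (simp add: J_def abs_mult mult_left_mono)
      qed
      show "((\<lambda>t. t powr (1 - \<nu>) * (C * t)) \<longlongrightarrow> 0) (at_right 0)"
        using \<nu> by real_asymp
    qed
  qed
  then have "\<forall>\<^sub>F t in at_right 0. J t\<^sub>0 < J t"
    using J_t\<^sub>0 by (rule order_tendstoD)
  then obtain \<delta> where \<delta>: "0 < \<delta>" "\<And>t. 0 < t \<Longrightarrow> t < \<delta> \<Longrightarrow> J t\<^sub>0 < J t"
    by (auto simp: eventually_at_right_field)
  have "((\<lambda>t. Mainardi \<nu> (t powr (- \<nu>))) \<longlongrightarrow> Mainardi \<nu> 0) at_top"
  proof (rule isCont_tendsto_compose[OF isCont_Mainardi])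
    show "((\<lambda>t. t powr (- \<nu>)) \<longlongrightarrow> 0) at_top" using \<nu> by real_asymp
  qed
  then have "\<forall>\<^sub>F t in at_top. 0 < Mainardi \<nu> (t powr (- \<nu>))"
    using Mainardi_0_pos by (rule order_tendstoD)
  then obtain A where A: "\<And>t. A \<le> t \<Longrightarrow> 0 < Mainardi \<nu> (t powr (- \<nu>))"
    by (auto simp: eventually_at_top_linorder)
  \<comment> \<open>Minimising over \<open>{\<delta>..B}\<close> is enough: to the left the values
    exceed \<open>J t\<^sub>0\<close>, to the right they are positive.\<close>
  define B where "B = max A t\<^sub>0"
  have "\<delta> \<le> t\<^sub>0" using \<delta>(2)[OF t\<^sub>0] by (rule_tac ccontr) auto
  then have t\<^sub>0_in: "t\<^sub>0 \<in> {\<delta>..B}" by (simp add: B_def)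
  have "continuous_on {\<delta>..B} J"
    using J_deriv \<delta>(1) by (intro continuous_at_imp_continuous_on ballI DERIV_isCont[OF J_deriv]) auto
  from continuous_attains_inf[OF compact_Icc _ this] t\<^sub>0_in
  obtain T where T: "T \<in> {\<delta>..B}" "\<And>t. t \<in> {\<delta>..B} \<Longrightarrow> J T \<le> J t" by auto
  have T0: "0 < T" using T(1) \<delta>(1) by simp
  have J_T: "J T \<le> J t\<^sub>0" using T(2) t\<^sub>0_in by blast
  have J_min: "J T \<le> J t" if "0 < t" for t
  proof (cases "t < \<delta> \<or> B < t")
    case True
    then show ?thesis
    proof
      assume "t < \<delta>" then show ?thesis using \<delta>(2)[of t] that J_T by simp
    next
      assume "B < t"
      then have "0 < J t" using A[of t] that by (simp add: B_def J_def mainardi_kernel_eq)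
      then show ?thesis using J_T J_t\<^sub>0 by simp
    qed
  qed (use T(2) in auto)
  define m where "m = - J T"
  have m: "0 < m" using J_T J_t\<^sub>0 by (simp add: m_def)
  have G_J: "?G t = J t * t powr (\<nu> - 1)" if "0 < t" for t
    using that by (simp add: J_def powr_add[symmetric])
  have K_le: "wright_kernel \<nu> (1 - 2 * \<nu>) 1 T \<le> 0"
  proof (rule mainardi_fractional_derivative_at_minimum[OF T0])
    show "?G T = - (m * T powr (\<nu> - 1))" using G_J[OF T0] by (simp add: m_def)
    show "- (m * t powr (\<nu> - 1)) \<le> ?G t" if "0 < t" for t
      using J_min[OF that] G_J[OF that] by (simp add: m_def mult_right_mono)
  qed
  have "(1 - \<nu>) * T powr (- \<nu>) * ?G T + T powr (1 - \<nu>) * wright_kernel \<nu> (- \<nu>) 1 T = 0"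
  proof (rule DERIV_local_min[OF J_deriv[OF T0], of T])
    show "\<forall>y. \<bar>T - y\<bar> < T \<longrightarrow> J T \<le> J y" using J_min by auto
  qed (use T0 in auto)
  moreover have "T powr (1 - \<nu>) = T powr (- \<nu>) * T" using T0 powr_add[of T "- \<nu>" 1] by simp
  ultimately have "T powr (- \<nu>) * ((1 - \<nu>) * ?G T + T * wright_kernel \<nu> (- \<nu>) 1 T) = 0"
    by (simp add: algebra_simps)
  then have "(1 - \<nu>) * ?G T + T * wright_kernel \<nu> (- \<nu>) 1 T = 0" using T0 by simp
  \<comment> \<open>The time derivative of G is eliminated between J'(T) = 0 and the recurrence. The
    result is positive, since 2 \<nu> - 1 and G(T) are both negative.\<close>
  then have "\<nu> * wright_kernel \<nu> (1 - 2 * \<nu>) 1 T = (2 * \<nu> - 1) * ?G T"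
    using mainardi_kernel_recurrence[OF T0] by (simp add: algebra_simps)
  also have "\<dots> = (1 - 2 * \<nu>) * (m * T powr (\<nu> - 1))"
    using G_J[OF T0] by (simp add: m_def algebra_simps)
  also have "\<dots> > 0" using \<nu> m T0 by simp
  finally show False using K_le \<nu> by (simp add: zero_less_mult_iff)
qed

text \<open>This is -M_\<nu>'(z). For z > 0 it is a value of g_(1-2\<nu>), up to a Gamma factor the
  fractional integral of g_0; the recurrence at b = 1 loses its first term and makes t g_0 a
  nonnegative multiple of a value of M_\<nu>.\<close>

lemma Wright_derivative_nonneg:
  assumes "0 \<le> z"
  shows "0 \<le> Wright (- z) (- \<nu>) (1 - 2 * \<nu>)"
proof (cases "z = 0")
  case True
  then show ?thesis using \<nu> Gamma_real_pos[of "1 - 2 * \<nu>"] by (simp add: Wright_0 rGamma_inverse_Gamma)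
next
  case False
  with assms have z: "0 < z" by simp
  have nonneg: "0 \<le> wright_kernel \<nu> 0 z t" if t: "0 < t" for t
  proof -
    have "t * wright_kernel \<nu> 0 z t = \<nu> * z * (t powr (- \<nu>) * Mainardi \<nu> (z * t powr (- \<nu>)))"
      using wright_kernel_recurrence[of \<nu> 1 t z] \<nu> t by (simp add: wright_kernel_def Mainardi_def)
    also have "\<dots> \<ge> 0"
      using \<nu> z t Mainardi_nonneg[of "z * t powr (- \<nu>)"] by simp
    finally show ?thesis using t by (simp add: zero_le_mult_iff)
  qed
  have int: "((\<lambda>\<tau>. wright_kernel \<nu> 0 z \<tau> / (1 - \<tau>) powr (1 - (1 - 2 * \<nu>))) has_integral
        Gamma (1 - 2 * \<nu>) * wright_kernel \<nu> (0 + (1 - 2 * \<nu>)) z 1) {0<..<1}"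
    using fractional_integral_wright_kernel[OF z, of "1 - 2 * \<nu>" 0 1] \<nu>
    unfolding has_integral_Icc_iff_Ioo by simp
  have "0 \<le> Gamma (1 - 2 * \<nu>) * wright_kernel \<nu> (0 + (1 - 2 * \<nu>)) z 1"
    by (rule has_integral_nonneg[OF int]) (use nonneg in auto)
  moreover have "0 < Gamma (1 - 2 * \<nu>)" using \<nu> by (intro Gamma_real_pos) simp
  ultimately show ?thesis by (simp add: zero_le_mult_iff wright_kernel_def)
qed

lemma has_derivative_Mainardi:
  "(Mainardi \<nu> has_real_derivative - Wright (- z) (- \<nu>) (1 - 2 * \<nu>)) (at z)"
proof -
  have "((\<lambda>z. Wright (- z) (- \<nu>) (1 - \<nu>)) has_real_derivative Wright (- z) (- \<nu>) (1 - \<nu> - \<nu>) * - 1) (at z)"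
    by (rule DERIV_chain2[OF has_derivative_Wright]) (use \<nu> in \<open>auto intro!: derivative_eq_intros\<close>)
  then show ?thesis by (simp add: Mainardi_def[abs_def])
qed

lemma Mainardi_antimono:
  assumes "0 \<le> y" "y \<le> z"
  shows "Mainardi \<nu> z \<le> Mainardi \<nu> y"
proof (rule DERIV_nonpos_imp_nonincreasing[OF assms(2)])
  fix w assume "y \<le> w" "w \<le> z"
  then show "\<exists>d. (Mainardi \<nu> has_real_derivative d) (at w) \<and> d \<le> 0"
    using has_derivative_Mainardi[of w] Wright_derivative_nonneg[of w] assms
    by (intro exI[of _ "- Wright (- w) (- \<nu>) (1 - 2 * \<nu>)"]) auto
qed

text \<open>Past a zero, monotonicity and nonnegativity force M_\<nu> to vanish on a half line. Its
  power series is entire, so it would vanish identically, against M_\<nu>(0) > 0.\<close>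

lemma Mainardi_pos:
  assumes z: "0 \<le> z"
  shows "0 < Mainardi \<nu> z"
proof (rule ccontr)
  assume "\<not> 0 < Mainardi \<nu> z"
  have zero: "Mainardi \<nu> y = 0" if "z < y" for y
    using Mainardi_antimono[OF z, of y] Mainardi_nonneg[of y] that z \<open>\<not> 0 < Mainardi \<nu> z\<close> by simp
  define c where "c n = complex_of_real (wright_coeff \<nu> (1 - \<nu>) n)" for n
  define f where "f w = (\<Sum>n. c n * w ^ n)" for w
  have summable: "summable (\<lambda>n. c n * w ^ n)" for w
  proof (rule summable_norm_cancel)
    show "summable (\<lambda>n. norm (c n * w ^ n))"
      using summable_wright_abs[of "1 - \<nu>" \<nu> "norm w"] \<nu> by (simp add: c_def norm_mult norm_power abs_mult)
  qed
  have f_hol: "f holomorphic_on UNIV"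
    unfolding f_def holomorphic_on_def field_differentiable_def
    using termdiffs_strong_converges_everywhere[OF summable] by (auto intro: has_field_derivative_at_within)
  have f_real: "f (of_real (- y)) = of_real (Mainardi \<nu> y)" for y
  proof -
    have "(\<lambda>n. of_real (wright_coeff \<nu> (1 - \<nu>) n * (- y) ^ n)) sums complex_of_real (Mainardi \<nu> y)"
      unfolding sums_of_real_iff Mainardi_def Wright_eq_suminf
      using \<nu> by (intro summable_sums summable_wright) auto
    then show ?thesis by (simp add: f_def c_def sums_iff)
  qed
  have "f (of_real (- 0)) = 0"
  proof (rule analytic_continuation[OF f_hol, of "(\<lambda>y. of_real (- y)) ` {z<..}" "of_real (- (z + 1))"])
    show "complex_of_real (- (z + 1)) islimpt (\<lambda>y. of_real (- y)) ` {z<..}"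
      unfolding islimpt_approachable
    proof (intro allI impI)
      fix e :: real assume "0 < e"
      then show "\<exists>w\<in>(\<lambda>y. complex_of_real (- y)) ` {z<..}. w \<noteq> of_real (- (z + 1)) \<and> dist w (of_real (- (z + 1))) < e"
        by (intro bexI[of _ "of_real (- (z + 1 + e / 2))"] imageI conjI)
           (auto simp: dist_norm norm_minus_commute simp flip: of_real_add of_real_minus of_real_diff)
    qed
  qed (auto simp: f_real zero simp del: of_real_minus)
  then show False using f_real[of 0] Mainardi_0_pos by simp
qed

end

section \<open>The free boundary problem\<close>

text \<open>The derivative is known only inside (0,t), where \<open>deriv f\<close> may be replaced
  by \<open>g\<close>; the two end points form a null set.\<close>

lemma caputo_eqI:
  assumes deriv: "\<And>\<tau>. 0 < \<tau> \<Longrightarrow> \<tau> < t \<Longrightarrow> (f has_real_derivative g \<tau>) (at \<tau>)"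
    and int: "((\<lambda>\<tau>. g \<tau> / (t - \<tau>) powr a) has_integral I) {0..t}"
  shows "caputo_exists a f t" and "caputo a f t = I / Gamma (1 - a)"
proof -
  have "((\<lambda>\<tau>. deriv f \<tau> / (t - \<tau>) powr a) has_integral I) {0..t}"
    using int unfolding has_integral_Icc_iff_Ioo
    by (rule has_integral_eq[rotated]) (use DERIV_imp_deriv[OF deriv] in auto)
  then show "caputo a f t = I / Gamma (1 - a)" "caputo_exists a f t"
    unfolding caputo_def caputo_exists_def real_differentiable_def
    using deriv by (simp_all add: integral_unique) (meson greaterThanLessThan_iff has_integral_integrable)
qed

text \<open>The integral is Euler's Beta integral scaled to [0,t]; dividing Beta(p, 1 - a) by
  Gamma(1 - a) leaves the Gamma quotient.\<close>

lemma caputo_powr: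
  assumes "0 < p" "a < 1" "0 < t"
  shows "caputo_exists a (\<lambda>\<tau>. C * \<tau> powr p) t"
    and "caputo a (\<lambda>\<tau>. C * \<tau> powr p) t = C * Gamma (1 + p) / Gamma (1 + p - a) * t powr (p - a)"
proof -
  have Beta: "((\<lambda>u. u powr (p - 1) * (1 - u) powr (1 - a - 1)) has_integral Beta p (1 - a)) {0..1}"
    using has_integral_Beta_real[of p "1 - a"] assms by simp
  have "((\<lambda>\<tau>. (\<tau> / t) powr (p - 1) * (1 - \<tau> / t) powr (- a)) has_integral t * Beta p (1 - a)) {0..t}"
    using has_integral_affinity'[OF Beta[folded cbox_interval], of "1 / t" 0] assms
    by (simp add: divide_inverse mult.commute)
  then have "((\<lambda>\<tau>. (\<tau> / t) powr (p - 1) * (1 - \<tau> / t) powr (- a)) has_integral t * Beta p (1 - a)) {0<..<t}"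
    unfolding has_integral_Icc_iff_Ioo .
  from has_integral_mult_right[OF this, of "C * p * t powr (p - 1 - a)"]
  have "((\<lambda>\<tau>. C * (p * \<tau> powr (p - 1)) / (t - \<tau>) powr a) has_integral
      C * p * t powr (p - 1 - a) * (t * Beta p (1 - a))) {0<..<t}"
  proof (rule has_integral_eq[rotated])
    fix \<tau> assume "\<tau> \<in> {0<..<t}"
    then have \<tau>: "0 < \<tau>" "\<tau> < t" by auto
    have 1: "(\<tau> / t) powr (p - 1) = \<tau> powr (p - 1) / t powr (p - 1)"
      using \<tau> by (simp add: powr_divide)
    have "1 - \<tau> / t = (t - \<tau>) / t" using assms by (simp add: diff_divide_distrib)
    then have 2: "(1 - \<tau> / t) powr (- a) = (t - \<tau>) powr (- a) / t powr (- a)"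
      using \<tau> assms by (simp add: powr_divide)
    have 3: "t powr (p - 1 - a) = t powr (p - 1) * t powr (- a)"
      by (simp add: powr_add[symmetric])
    show "C * p * t powr (p - 1 - a) * ((\<tau> / t) powr (p - 1) * (1 - \<tau> / t) powr (- a)) =
        C * (p * \<tau> powr (p - 1)) / (t - \<tau>) powr a"
      unfolding 1 2 3 using assms by (simp add: powr_minus_divide)
  qed
  then have int: "((\<lambda>\<tau>. C * (p * \<tau> powr (p - 1)) / (t - \<tau>) powr a) has_integral
      C * p * t powr (p - 1 - a) * (t * Beta p (1 - a))) {0..t}"
    unfolding has_integral_Icc_iff_Ioo .
  have deriv: "((\<lambda>\<tau>. C * \<tau> powr p) has_real_derivative C * (p * \<tau> powr (p - 1))) (at \<tau>)" if "0 < \<tau>" for \<tau>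
    by (rule derivative_eq_intros refl | use that in simp)+
  show "caputo_exists a (\<lambda>\<tau>. C * \<tau> powr p) t"
    by (rule caputo_eqI(1)[OF deriv int])
  have "caputo a (\<lambda>\<tau>. C * \<tau> powr p) t = C * p * t powr (p - 1 - a) * (t * Beta p (1 - a)) / Gamma (1 - a)"
    by (rule caputo_eqI(2)[OF deriv int])
  also have "\<dots> = C * (p * Gamma p) / Gamma (1 + p - a) * (t powr (p - 1 - a) * t powr 1)"
    using less_imp_neq[OF Gamma_real_pos[of "1 - a"]] assms by (simp add: Beta_def algebra_simps)
  also have "p * Gamma p = Gamma (1 + p)"
    using assms Gamma_plus1[of p] by (simp add: add.commute nonpos_Ints_def) 
  also have "t powr (p - 1 - a) * t powr 1 = t powr (p - a)"
    by (simp only: powr_add[symmetric]) simp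
  finally show "caputo a (\<lambda>\<tau>. C * \<tau> powr p) t = C * Gamma (1 + p) / Gamma (1 + p - a) * t powr (p - a)" .
qed

section \<open>The front equation and the similarity profile\<close>

context half_order
begin

text \<open>The primitive of M_\<nu> that vanishes at 0. It takes the place of the error function in
  the classical Stefan problem.\<close>

definition mainardi_cdf :: "real \<Rightarrow> real" where
  "mainardi_cdf z = 1 - Wright (- z) (- \<nu>) 1"

lemma has_derivative_mainardi_cdf: "(mainardi_cdf has_real_derivative Mainardi \<nu> z) (at z)"
proof -
  have "((\<lambda>z. Wright (- z) (- \<nu>) 1) has_real_derivative Wright (- z) (- \<nu>) (1 - \<nu>) * - 1) (at z)"
    by (rule DERIV_chain2[OF has_derivative_Wright]) (use \<nu> in \<open>auto intro!: derivative_eq_intros\<close>)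
  from DERIV_diff[OF DERIV_const[of 1] this] show ?thesis
    by (simp add: mainardi_cdf_def[abs_def] Mainardi_def)
qed

lemma mainardi_cdf_0: "mainardi_cdf 0 = 0"
  by (simp add: mainardi_cdf_def Wright_0 rGamma_inverse_Gamma)

lemma mainardi_cdf_strict_mono:
  assumes "0 \<le> y" "y < z"
  shows "mainardi_cdf y < mainardi_cdf z"
  using assms by (intro DERIV_pos_imp_increasing[OF assms(2)]) (meson has_derivative_mainardi_cdf Mainardi_pos order_trans)

lemma mainardi_cdf_pos: "0 < z \<Longrightarrow> 0 < mainardi_cdf z"
  using mainardi_cdf_strict_mono[of 0 z] mainardi_cdf_0 by simp

text \<open>The numerator is strictly increasing and the denominator positive and nonincreasing,
  which gives uniqueness; existence follows from the intermediate value theorem.\<close>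

lemma front_equation_unique_solution:
  assumes K: "0 < K"
  shows "\<exists>!\<xi>. 0 < \<xi> \<and> \<xi> * mainardi_cdf \<xi> / Mainardi \<nu> \<xi> = K"
proof (rule ex_ex1I)
  define h where "h z = z * mainardi_cdf z / Mainardi \<nu> z" for z
  have mono: "h y < h z" if "0 < y" "y < z" for y z
  proof -
    have "y * mainardi_cdf y < z * mainardi_cdf z"
      using that mainardi_cdf_strict_mono[of y z] mainardi_cdf_pos[of y] by (intro mult_strict_mono) auto
    moreover have "Mainardi \<nu> z \<le> Mainardi \<nu> y" "0 < Mainardi \<nu> z"
      using that Mainardi_antimono Mainardi_pos by auto
    ultimately show ?thesis
      using that mainardi_cdf_pos[of y] unfolding h_def by (intro frac_less) auto
  qed
  show "\<exists>\<xi>. 0 < \<xi> \<and> \<xi> * mainardi_cdf \<xi> / Mainardi \<nu> \<xi> = K"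
  proof -
    \<comment> \<open>Chosen so that X times \<open>mainardi_cdf 1\<close> is at least K M_\<nu>(0).
      For X \<ge> 1 monotonicity then puts the quotient at X above K.\<close>
    define X where "X = max 1 (K * Mainardi \<nu> 0 / mainardi_cdf 1)"
    have X: "1 \<le> X" "K * Mainardi \<nu> 0 / mainardi_cdf 1 \<le> X" by (auto simp: X_def)
    have "K * Mainardi \<nu> X \<le> K * Mainardi \<nu> 0"
      using K X Mainardi_antimono[of 0 X] by simp
    also have "\<dots> \<le> X * mainardi_cdf 1" using X(2) mainardi_cdf_pos[of 1] by (simp add: field_simps)
    also have "\<dots> \<le> X * mainardi_cdf X"
      using X mainardi_cdf_strict_mono[of 1 X] by (cases "X = 1") auto
    finally have "K \<le> h X"
      unfolding h_def using Mainardi_pos[of X] X by (simp add: field_simps)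
    moreover have "h 0 \<le> K" using K by (simp add: h_def)
    moreover have "isCont h z" if "0 \<le> z" for z
      unfolding h_def using Mainardi_pos[OF that] isCont_Mainardi DERIV_isCont[OF has_derivative_mainardi_cdf]
      by (intro continuous_intros) auto
    ultimately obtain \<xi> where \<xi>: "0 \<le> \<xi>" "h \<xi> = K"
      using IVT[of h 0 K X] X by auto
    moreover have "\<xi> \<noteq> 0" using \<xi> K by (auto simp: h_def)
    ultimately show ?thesis by (intro exI[of _ \<xi>]) (simp add: h_def)
  qed
  fix y z assume "0 < y \<and> y * mainardi_cdf y / Mainardi \<nu> y = K" "0 < z \<and> z * mainardi_cdf z / Mainardi \<nu> z = K"
  then show "y = z"
    using mono[of y z] mono[of z y] by (cases y z rule: linorder_cases) (auto simp: h_def)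
qed

text \<open>The time derivative of the profile is B g_0(x/l, \<tau>), and the Caputo integral of
  order 2 \<nu> is a fractional integral of order 1 - 2 \<nu>, which sends g_0 to
  g_(1-2\<nu>).\<close>

lemma caputo_similarity_profile:
  assumes "0 < x" "0 < l" "0 < t"
  shows "caputo_exists (2 * \<nu>) (\<lambda>\<tau>. A - B * mainardi_cdf (x / (l * \<tau> powr \<nu>))) t"
    and "caputo (2 * \<nu>) (\<lambda>\<tau>. A - B * mainardi_cdf (x / (l * \<tau> powr \<nu>))) t =
           B * (t powr (- (2 * \<nu>)) * Wright (- (x / (l * t powr \<nu>))) (- \<nu>) (1 - 2 * \<nu>))"
proof -
  have arg: "x / (l * \<tau> powr \<nu>) = x / l * \<tau> powr (- \<nu>)" for \<tau>
    by (simp add: powr_minus divide_inverse)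
  \<comment> \<open>Positivity of \<tau> matters: at \<tau> = 0 division by zero makes the left side
    A, while the right side is A - B.\<close>
  have f_eq: "A - B * mainardi_cdf (x / (l * \<tau> powr \<nu>)) = A - B + B * wright_kernel \<nu> 1 (x / l) \<tau>" if "0 < \<tau>" for \<tau>
    unfolding arg using that by (simp add: mainardi_cdf_def wright_kernel_def algebra_simps)
  have deriv: "((\<lambda>\<tau>. A - B * mainardi_cdf (x / (l * \<tau> powr \<nu>))) has_real_derivative B * wright_kernel \<nu> 0 (x / l) \<tau>) (at \<tau>)"
    if "0 < \<tau>" for \<tau>
  proof (rule has_field_derivative_transform_within_open[of _ _ _ "{0<..}"])
    have "(wright_kernel \<nu> 1 (x / l) has_real_derivative wright_kernel \<nu> 0 (x / l) \<tau>) (at \<tau>)"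
      using has_derivative_wright_kernel[of \<nu> 1 \<tau> "x / l"] \<nu> that by simp
    from DERIV_add[OF DERIV_const[of "A - B"] DERIV_cmult[OF this, of B]]
    show "((\<lambda>\<tau>. A - B + B * wright_kernel \<nu> 1 (x / l) \<tau>) has_real_derivative B * wright_kernel \<nu> 0 (x / l) \<tau>) (at \<tau>)"
      by simp
  qed (use that f_eq in auto)
  have int: "((\<lambda>\<tau>. B * wright_kernel \<nu> 0 (x / l) \<tau> / (t - \<tau>) powr (2 * \<nu>)) has_integral
      B * (Gamma (1 - 2 * \<nu>) * wright_kernel \<nu> (1 - 2 * \<nu>) (x / l) t)) {0..t}"
    using has_integral_mult_right[OF fractional_integral_wright_kernel[of "x / l" "1 - 2 * \<nu>" 0 t], of B] assms \<nu>
    by simp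
  show "caputo_exists (2 * \<nu>) (\<lambda>\<tau>. A - B * mainardi_cdf (x / (l * \<tau> powr \<nu>))) t"
    by (rule caputo_eqI(1)[OF deriv int])
  have "0 < Gamma (1 - 2 * \<nu>)" using \<nu> by (intro Gamma_real_pos) simp
  moreover have "caputo (2 * \<nu>) (\<lambda>\<tau>. A - B * mainardi_cdf (x / (l * \<tau> powr \<nu>))) t =
      B * (Gamma (1 - 2 * \<nu>) * wright_kernel \<nu> (1 - 2 * \<nu>) (x / l) t) / Gamma (1 - 2 * \<nu>)"
    by (rule caputo_eqI(2)[OF deriv int])
  ultimately show "caputo (2 * \<nu>) (\<lambda>\<tau>. A - B * mainardi_cdf (x / (l * \<tau> powr \<nu>))) t =
           B * (t powr (- (2 * \<nu>)) * Wright (- (x / (l * t powr \<nu>))) (- \<nu>) (1 - 2 * \<nu>))"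
    unfolding arg by (simp add: wright_kernel_def)
qed

text \<open>Stated as an equality of functions, so that it can be rewritten under the second
  \<open>deriv\<close>.\<close>

lemma deriv_similarity_profile:
  assumes "r \<noteq> 0"
  shows "deriv (\<lambda>z. A - B * mainardi_cdf (z / r)) = (\<lambda>z. - (B / r) * Mainardi \<nu> (z / r))"
proof
  fix z
  have "((\<lambda>z. mainardi_cdf (z / r)) has_real_derivative Mainardi \<nu> (z / r) * (1 / r)) (at z)"
    by (rule DERIV_chain2[OF has_derivative_mainardi_cdf]) (use assms in \<open>auto intro!: derivative_eq_intros\<close>)
  from DERIV_diff[OF DERIV_const[of A] DERIV_cmult[OF this, of B]]
  show "deriv (\<lambda>z. A - B * mainardi_cdf (z / r)) z = - (B / r) * Mainardi \<nu> (z / r)"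
    by (intro DERIV_imp_deriv) simp
qed

lemma deriv2_similarity_profile:
  assumes "r \<noteq> 0"
  shows "deriv (deriv (\<lambda>z. A - B * mainardi_cdf (z / r))) z = B / r\<^sup>2 * Wright (- (z / r)) (- \<nu>) (1 - 2 * \<nu>)"
  unfolding deriv_similarity_profile[OF assms]
proof (rule DERIV_imp_deriv)
  have "((\<lambda>z. Mainardi \<nu> (z / r)) has_real_derivative - Wright (- (z / r)) (- \<nu>) (1 - 2 * \<nu>) * (1 / r)) (at z)"
    by (rule DERIV_chain2[OF has_derivative_Mainardi]) (use assms in \<open>auto intro!: derivative_eq_intros\<close>)
  from DERIV_cmult[OF this, of "- (B / r)"]
  show "((\<lambda>z. - (B / r) * Mainardi \<nu> (z / r)) has_real_derivative B / r\<^sup>2 * Wright (- (z / r)) (- \<nu>) (1 - 2 * \<nu>)) (at z)"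
    by (simp add: power2_eq_square)
qed

end

section \<open>Verification of the explicit solution\<close>

theorem theorem8:
  fixes \<alpha> k c L Tm T0 q0 :: real
  assumes "0 < \<alpha>" "\<alpha> < 1" "0 < k" "0 < c" "0 < L" "Tm < T0" "0 < q0"
  shows "(\<exists>!\<xi>. 0 < \<xi> \<and>
            \<xi> * (1 - Wright (- \<xi>) (- \<alpha> / 2) 1) / Mainardi (\<alpha> / 2) \<xi> =
            c * (T0 - Tm) * Gamma (1 - \<alpha> / 2) / (L * Gamma (1 + \<alpha> / 2)))
    \<and> (\<forall>\<xi>. 0 < \<xi> \<and>
            \<xi> * (1 - Wright (- \<xi>) (- \<alpha> / 2) 1) / Mainardi (\<alpha> / 2) \<xi> =
            c * (T0 - Tm) * Gamma (1 - \<alpha> / 2) / (L * Gamma (1 + \<alpha> / 2)) \<longrightarrow>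
        (let \<rho> = q0\<^sup>2 * (Gamma (1 - \<alpha> / 2))\<^sup>2 / (k * c * (T0 - Tm)\<^sup>2)
                  * (1 - Wright (- \<xi>) (- \<alpha> / 2) 1)\<^sup>2;
             lam = k * (T0 - Tm) / (q0 * Gamma (1 - \<alpha> / 2) * (1 - Wright (- \<xi>) (- \<alpha> / 2) 1));
             s = (\<lambda>t. lam * \<xi> * t powr (\<alpha> / 2));
             T = (\<lambda>x t. T0 - (T0 - Tm) / (1 - Wright (- \<xi>) (- \<alpha> / 2) 1)
                   * (1 - Wright (- (x / (lam * t powr (\<alpha> / 2)))) (- \<alpha> / 2) 1))
         in 0 < \<rho> \<and> s 0 = 0 \<and>
            (\<forall>t>0. \<forall>x. 0 < x \<and> x < s t \<longrightarrow>
                caputo_exists \<alpha> (\<lambda>\<tau>. T x \<tau>) t \<and>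
                caputo \<alpha> (\<lambda>\<tau>. T x \<tau>) t = k / (\<rho> * c) * deriv (\<lambda>y. deriv (\<lambda>z. T z t) y) x) \<and>
            (\<forall>t>0. T (s t) t = Tm) \<and>
            (\<forall>t>0. caputo_exists \<alpha> s t \<and>
                - k * deriv (\<lambda>z. T z t) (s t) = \<rho> * L * caputo \<alpha> s t) \<and>
            (\<forall>t>0. T 0 t = T0) \<and>
            (\<forall>t>0. k * deriv (\<lambda>z. T z t) 0 = - q0 / t powr (\<alpha> / 2))))"
proof -
  define \<nu> where "\<nu> = \<alpha> / 2"
  interpret half_order \<nu> by unfold_locales (use assms in \<open>auto simp: \<nu>_def\<close>)
  have \<nu>_eq: "- \<alpha> / 2 = - \<nu>" "\<alpha> / 2 = \<nu>" "\<alpha> = 2 * \<nu>" by (simp_all add: \<nu>_def)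
  define \<Delta> where "\<Delta> = T0 - Tm"
  define g where "g = Gamma (1 - \<nu>)"
  define g' where "g' = Gamma (1 + \<nu>)"
  have pos: "0 < \<Delta>" "0 < g" "0 < g'"
    using assms \<nu> by (auto simp: \<Delta>_def g_def g'_def intro!: Gamma_real_pos)
  show ?thesis
    unfolding \<nu>_eq(1,2) mainardi_cdf_def[symmetric] \<Delta>_def[symmetric] g_def[symmetric] g'_def[symmetric]
  proof (intro conjI allI impI, goal_cases)
    case 1
    show "\<exists>!\<xi>. 0 < \<xi> \<and> \<xi> * mainardi_cdf \<xi> / Mainardi \<nu> \<xi> = c * \<Delta> * g / (L * g')"
      using assms pos by (intro front_equation_unique_solution) simp
  next
    case (2 \<xi>)
    note \<xi> = this
    define F where "F = mainardi_cdf \<xi>"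
    \<comment> \<open>The flux condition at x = 0, where M_\<nu>(0) = 1/g, forces the value of
      \<open>lam\<close>; the density is then fixed by k/(\<rho> c) =
      \<open>lam\<^sup>2\<close>.\<close>
    define \<rho> where "\<rho> = q0\<^sup>2 * g\<^sup>2 / (k * c * \<Delta>\<^sup>2) * F\<^sup>2"
    define lam where "lam = k * \<Delta> / (q0 * g * F)"
    define s where "s = (\<lambda>t. lam * \<xi> * t powr \<nu>)"
    define T where "T = (\<lambda>x t. T0 - \<Delta> / F * mainardi_cdf (x / (lam * t powr \<nu>)))"
    have F: "0 < F" using \<xi> mainardi_cdf_pos by (simp add: F_def)
    have lam: "0 < lam" using assms pos F by (simp add: lam_def)
    have \<rho>: "0 < \<rho>" using assms pos F by (simp add: \<rho>_def)
    have lam_sq: "k / (\<rho> * c) = lam\<^sup>2"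
      unfolding \<rho>_def lam_def using assms pos F by (simp add: field_simps power2_eq_square)
    have scale: "lam * t powr \<nu> \<noteq> 0" if "0 < t" for t using that lam by simp
    have T_x: "deriv (\<lambda>z. T z t) x = - (\<Delta> / F / (lam * t powr \<nu>)) * Mainardi \<nu> (x / (lam * t powr \<nu>))"
      if "0 < t" for t x
      unfolding T_def deriv_similarity_profile[OF scale[OF that]] ..
    have heat: "caputo_exists \<alpha> (\<lambda>\<tau>. T x \<tau>) t"
        "caputo \<alpha> (\<lambda>\<tau>. T x \<tau>) t = k / (\<rho> * c) * deriv (\<lambda>y. deriv (\<lambda>z. T z t) y) x"
      if "0 < t" "0 < x" for t x
    proof -
      show "caputo_exists \<alpha> (\<lambda>\<tau>. T x \<tau>) t"
        unfolding T_def \<nu>_eq(3) by (rule caputo_similarity_profile(1)[OF \<open>0 < x\<close> lam \<open>0 < t\<close>])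
      have "deriv (\<lambda>y. deriv (\<lambda>z. T z t) y) x =
          \<Delta> / F / (lam * t powr \<nu>)\<^sup>2 * Wright (- (x / (lam * t powr \<nu>))) (- \<nu>) (1 - 2 * \<nu>)"
        unfolding T_def by (rule deriv2_similarity_profile[OF scale[OF \<open>0 < t\<close>]])
      moreover have "caputo \<alpha> (\<lambda>\<tau>. T x \<tau>) t =
          \<Delta> / F * (t powr (- (2 * \<nu>)) * Wright (- (x / (lam * t powr \<nu>))) (- \<nu>) (1 - 2 * \<nu>))"
        unfolding T_def \<nu>_eq(3) by (rule caputo_similarity_profile(2)[OF \<open>0 < x\<close> lam \<open>0 < t\<close>])
      \<comment> \<open>This matches the time factor of the Caputo derivative with the scale factor
        of the second space derivative, leaving the diffusivity \<open>lam\<^sup>2\<close>.\<close>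
      moreover have "t powr (- (2 * \<nu>)) = lam\<^sup>2 / (lam * t powr \<nu>)\<^sup>2"
      proof -
        have "(t powr \<nu>)\<^sup>2 = t powr (2 * \<nu>)"
          by (simp add: power2_eq_square powr_add[symmetric])
        then show ?thesis using lam by (simp add: power_mult_distrib powr_minus divide_inverse)
      qed
      ultimately show "caputo \<alpha> (\<lambda>\<tau>. T x \<tau>) t = k / (\<rho> * c) * deriv (\<lambda>y. deriv (\<lambda>z. T z t) y) x"
        unfolding lam_sq by simp
    qed
    have front: "s t / (lam * t powr \<nu>) = \<xi>" if "0 < t" for t
      using that lam by (simp add: s_def)
    have stefan: "- k * deriv (\<lambda>z. T z t) (s t) = \<rho> * L * caputo \<alpha> s t" if "0 < t" for t
    proof -
      \<comment> \<open>With \<alpha> = 2 \<nu> the Gamma quotient is g'/g and the power is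
        t^(-\<nu>), the same time dependence as that of the heat flux at the front.\<close>
      have "caputo \<alpha> s t = lam * \<xi> * Gamma (1 + \<nu>) / Gamma (1 + \<nu> - \<alpha>) * t powr (\<nu> - \<alpha>)"
        unfolding s_def using \<nu> assms that by (intro caputo_powr(2)) auto
      also have "\<dots> = lam * \<xi> * g' / g / t powr \<nu>"
        by (simp add: g_def g'_def \<nu>_eq(3) powr_minus divide_inverse)
      finally have "\<rho> * L * caputo \<alpha> s t = (\<rho> * lam) * (\<xi> * L * g') / g / t powr \<nu>" by simp
      also have "\<rho> * lam = q0 * g * F / (c * \<Delta>)"
        unfolding \<rho>_def lam_def using assms pos F by (simp add: field_simps power2_eq_square)
      also have "q0 * g * F / (c * \<Delta>) * (\<xi> * L * g') / g / t powr \<nu> = q0 * (\<xi> * F * (L * g')) / (c * \<Delta>) / t powr \<nu>"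
        using pos by simp
      \<comment> \<open>The front equation enters here: it is the Stefan condition with the time
        dependence removed.\<close>
      also have "\<xi> * F * (L * g') = c * \<Delta> * g * Mainardi \<nu> \<xi>"
        using \<xi> Mainardi_pos[of \<xi>] assms pos by (simp add: F_def field_simps)
      also have "q0 * (c * \<Delta> * g * Mainardi \<nu> \<xi>) / (c * \<Delta>) / t powr \<nu> = q0 * g * Mainardi \<nu> \<xi> / t powr \<nu>"
        using assms pos by simp
      also have "\<dots> = - k * deriv (\<lambda>z. T z t) (s t)"
        unfolding T_x[OF that] front[OF that] using assms pos F that by (simp add: lam_def field_simps)
      finally show ?thesis by simp
    qed
    have front_ex: "caputo_exists \<alpha> s t" if "0 < t" for t
      unfolding s_def using \<nu> assms that by (intro caputo_powr(1)) auto
    have melting: "T (s t) t = Tm" if "0 < t" for t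
      unfolding T_def front[OF that] F_def[symmetric] using F by (simp add: \<Delta>_def)
    have wall: "T 0 t = T0" for t
      by (simp add: T_def mainardi_cdf_0)
    have flux: "k * deriv (\<lambda>z. T z t) 0 = - q0 / t powr \<nu>" if "0 < t" for t
    proof -
      have "Mainardi \<nu> 0 = 1 / g"
        by (simp add: Mainardi_def Wright_0 rGamma_inverse_Gamma g_def divide_inverse)
      then show ?thesis
        unfolding T_x[OF that] using assms pos F that by (simp add: lam_def field_simps)
    qed
    have start: "s 0 = 0" by (simp add: s_def)
    have "0 < \<rho> \<and> s 0 = 0 \<and>
            (\<forall>t>0. \<forall>x. 0 < x \<and> x < s t \<longrightarrow>
                caputo_exists \<alpha> (\<lambda>\<tau>. T x \<tau>) t \<and>
                caputo \<alpha> (\<lambda>\<tau>. T x \<tau>) t = k / (\<rho> * c) * deriv (\<lambda>y. deriv (\<lambda>z. T z t) y) x) \<and>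
            (\<forall>t>0. T (s t) t = Tm) \<and>
            (\<forall>t>0. caputo_exists \<alpha> s t \<and>
                - k * deriv (\<lambda>z. T z t) (s t) = \<rho> * L * caputo \<alpha> s t) \<and>
            (\<forall>t>0. T 0 t = T0) \<and>
            (\<forall>t>0. k * deriv (\<lambda>z. T z t) 0 = - q0 / t powr \<nu>)"
      by (intro conjI allI impI \<rho> start heat melting front_ex stefan wall flux;
          (assumption | (elim conjE, assumption)))
    then show ?case
      unfolding Let_def T_def s_def lam_def \<rho>_def F_def .
  qed
qed

end
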